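(* Let $m\ge1$ and let $\psi_1,\ldots,\psi_m:\mathbb{N}\to(0,\infty)$ be any functions. (1) If \[ \dim_P\bigl(E(\psi_1)\times\cdots\times E(\psi_m)\bigr)=m, \] then \[ \liminf_{q\to\infty}q^2\psi_i(q)=0\qquad\text{for all } 1\le i\le m. \] (2) If \[ \dim_H\bigl(E(\psi_1)\times\cdots\times E(\psi_m)\bigr)=m-1+\min_{1\le i\le m}\dim_H E(\psi_i), \] then the equality $\liminf_{q\to\infty}q^2\psi_i(q)=0$ fails for at most one index $i\in\{1,\ldots,m\}$. Moreover, if it does fail for one index, this exceptional index is labelled $i=m$, $m\ge2$, and \[ \liminf_{q\to\infty}q^2\psi_m(q)>\frac13, \] then \[ \dim_H E(\psi_1)=\cdots=\dim_H E(\psi_{m-1})=1,\qquad \dim_H E(\psi_m)=0, \] and \[ \dim_H\bigl(E(\psi_1)\times\cdots\times E(\psi_m)\bigr)=\dim_P\bigl(E(\psi_1)\times\cdots\times E(\psi_m)\bigr)=m-1. \]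
   Context: $\mathbb{N}=\{1,2,\ldots\}$. For an arbitrary function $\psi:\mathbb{N}\to(0,\infty)$ let \[ W(\psi)=\left\{x\in[0,1):\left|x-\frac pq\right|<\psi(q)\text{ for infinitely many }(p,q)\in\mathbb{Z}\times\mathbb{N}\right\}, \qquad E(\psi)=W(\psi)\setminus\bigcup_{0<c<1}W(c\psi), \] where $c\psi$ denotes the function $q\mapsto c\,\psi(q)$. $\dim_H$ and $\dim_P$ denote Hausdorff and packing dimension (with the empty set having dimension $0$); the product set is a subset of $\mathbb{R}^m$ with its usual metric. *)

theory Defs
  imports "HOL-Analysis.Analysis"
begin

text \<open>Hausdorff measure and dimension. Boundedness of the covering sets is required explicitly
  because \<^const>\<open>diameter\<close> is 0 by convention on unbounded sets. Only exponents
  \<open>s > 0\<close> enter the dimension, so the value of \<open>0 powr 0\<close> plays no role; this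
  does not change the infimum, and the empty set gets dimension 0.\<close>

definition hausdorff_pre :: "real \<Rightarrow> real \<Rightarrow> 'a::metric_space set \<Rightarrow> ennreal" where
  "hausdorff_pre s \<delta> A =
     (INF U \<in> {U :: nat \<Rightarrow> 'a set. A \<subseteq> (\<Union>i. U i) \<and> (\<forall>i. bounded (U i) \<and> diameter (U i) \<le> \<delta>)}.
        \<Sum>i. ennreal (diameter (U i) powr s))"

definition hausdorff_measure :: "real \<Rightarrow> 'a::metric_space set \<Rightarrow> ennreal" where
  "hausdorff_measure s A = (SUP \<delta> \<in> {0<..}. hausdorff_pre s \<delta> A)"

definition dimH :: "'a::metric_space set \<Rightarrow> ereal" where
  "dimH A = (INF s \<in> {s. 0 < s \<and> hausdorff_measure s A = 0}. ereal s)"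

text \<open>Packing measure and dimension. A packing is a countable set of pairs (centre, radius) whose
  closed balls are pairwise disjoint; each ball contributes \<open>(2 r) powr s\<close>, where \<open>2 r\<close>
  is its diameter in Euclidean space.\<close>

definition packings :: "real \<Rightarrow> 'a::metric_space set \<Rightarrow> ('a \<times> real) set set" where
  "packings \<delta> A =
     {C. countable C \<and> C \<subseteq> A \<times> {0<..\<delta>} \<and> disjoint_family_on (\<lambda>(x, r). cball x r) C}"

definition packing_pre :: "real \<Rightarrow> real \<Rightarrow> 'a::metric_space set \<Rightarrow> ennreal" where
  "packing_pre s \<delta> A = (SUP C \<in> packings \<delta> A. \<Sum>\<^sub>\<infinity>(x, r)\<in>C. ennreal ((2 * r) powr s))"

definition packing_premeasure :: "real \<Rightarrow> 'a::metric_space set \<Rightarrow> ennreal" where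
  "packing_premeasure s A = (INF \<delta> \<in> {0<..}. packing_pre s \<delta> A)"

definition packing_measure :: "real \<Rightarrow> 'a::metric_space set \<Rightarrow> ennreal" where
  "packing_measure s A =
     (INF U \<in> {U :: nat \<Rightarrow> 'a set. A \<subseteq> (\<Union>i. U i)}. \<Sum>i. packing_premeasure s (U i))"

definition dimP :: "'a::metric_space set \<Rightarrow> ereal" where
  "dimP A = (INF s \<in> {s. 0 < s \<and> packing_measure s A = 0}. ereal s)"

text \<open>The denominators range over the positive integers; the value of \<open>\<psi>\<close> at 0 is
  never used.\<close>

definition W :: "(nat \<Rightarrow> real) \<Rightarrow> real set" where
  "W \<psi> = {x. 0 \<le> x \<and> x < 1 \<and>
     infinite {(p :: int, q :: nat). 1 \<le> q \<and> \<bar>x - of_int p / of_nat q\<bar> < \<psi> q}}"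

definition E :: "(nat \<Rightarrow> real) \<Rightarrow> real set" where
  "E \<psi> = W \<psi> - (\<Union>c\<in>{0<..<1}. W (\<lambda>q. c * \<psi> q))"

definition prodE :: "('n::finite \<Rightarrow> nat \<Rightarrow> real) \<Rightarrow> (real ^ 'n) set" where
  "prodE \<psi> = {x. \<forall>i. x $ i \<in> E (\<psi> i)}"

definition liminf_q2 :: "(nat \<Rightarrow> real) \<Rightarrow> ereal" where
  "liminf_q2 \<psi> = liminf (\<lambda>q. ereal ((real q)\<^sup>2 * \<psi> q))"

end

theory Submission
  imports Defs
begin

text \<open>If \<open>liminf q\<^sup>2 \<psi>(q) > 0\<close>, the points of \<open>E \<psi>\<close> have no approximation \<open>p/q\<close> better than \<open>\<epsilon>/q\<^sup>2\<close> for
  large \<open>q\<close>, with \<open>\<epsilon>\<close> depending on \<open>\<psi>\<close> only. By Dirichlet's theorem a fixed proportion of every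
  short interval is then excluded, so \<open>E \<psi>\<close> is a countable union of sets whose upper box dimension is
  at most some \<open>t < 1\<close>. Hence one such factor forces \<open>dim\<^sub>P \<le> m - 1 + t\<close> for the product, and two of
  them are incompatible with the equality in (2), because the Hausdorff dimension of \<open>A \<times> B\<close> is at
  most that of \<open>A\<close> plus the box dimension of \<open>B\<close>.

  If the lower limit exceeds \<open>1/3\<close>, then \<open>E \<psi>\<close> is countable (Markov): the partial quotients are
  eventually 1 or 2, and the digits come in pairs 1,1 and 2,2. The identity
  \<open>[0;1,1,X] + [0;2,X] = 1\<close> turns the bound on the approximation constant into a lexicographic
  condition on the word of pairs, decided within a bounded number \<open>L\<close> of letters. In such a word one
  of the two letters is eventually isolated, and undoing the substitution \<open>x \<mapsto> x\<close>, \<open>y \<mapsto> xy\<close> lowers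
  \<open>L\<close>, so there are only countably many words.\<close>

section \<open>Words satisfying Markov's condition\<close>

text \<open>The constants \<open>c < 1\<close> in the definition of \<open>E\<close> are used in two
  ways. Any positive \<epsilon> gives some \<open>t < 1\<close>, so \<open>c = 1/2\<close> serves
  for the dimension bounds; for the threshold 1/3, \<open>c\<close> must be so close to 1 that
  \<open>c * b > 1/3\<close> for some \<open>b\<close> below the lower limit. The excess over 1/3
  becomes a \<delta> common to all places of the expansion, and since a pair of digits contracts by
  4, \<delta> yields one \<open>L\<close> for all places. Countability asks only for a descent on
  this \<open>L\<close>, not for a description of the Markov spectrum.

  In the dimension part the obstacle is the finitely many small denominators, about which nothing
  uniform is known. They go into a second parameter \<open>h\<close>, and the exponent
  \<open>t\<close> has to be independent of \<open>h\<close>: a union of sets whose exponents tend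
  to 1 could have dimension 1.

  Hausdorff dimension may jump up under products, so the estimate for two factors is asymmetric: one
  factor supplies covering sets of varying size, the others covering numbers at each of these
  sizes.\<close>

text \<open>With \<open>True\<close> for the digits 1,1 and \<open>False\<close> for 2,2 of a continued fraction, \<open>markov_at\<close> encodes
  Markov's bound at a place \<open>i\<close>, \<open>i + 1\<close> where the letter changes: the words read outwards from
  there first differ after fewer than \<open>L\<close> common letters, and the letter on each side at this first
  difference is the one on the other side of the change.\<close>

definition markov_at :: "nat \<Rightarrow> (nat \<Rightarrow> bool) \<Rightarrow> nat \<Rightarrow> bool" where
  "markov_at L w i \<longleftrightarrow> (\<exists>j<L. (\<forall>k<j. w (i - 1 - k) = w (i + 2 + k)) \<and>
     w (i - 1 - j) = w (i + 1) \<and> w (i + 2 + j) = w i)"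

text \<open>The condition \<open>N > L\<close> keeps \<open>i - 1 - j\<close> in
  \<open>markov_at\<close> clear of truncated subtraction: for \<open>i \<ge> N\<close> and
  \<open>j < L\<close> it is at least 1.\<close>

definition markov_word :: "nat \<Rightarrow> (nat \<Rightarrow> bool) \<Rightarrow> bool" where
  "markov_word L w \<longleftrightarrow> (\<exists>N>L. \<forall>i\<ge>N. w i \<noteq> w (i + 1) \<longrightarrow> markov_at L w i)"

lemma countable_if_determined:
  assumes "countable K" "\<And>a. a \<in> A \<Longrightarrow> \<exists>k\<in>K. R a k"
    and "\<And>a b k. R a k \<Longrightarrow> R b k \<Longrightarrow> a = b"
  shows "countable A"
proof -
  from assms(2) obtain f where f: "\<And>a. a \<in> A \<Longrightarrow> f a \<in> K \<and> R a (f a)"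
    by metis
  have "inj_on f A"
    using f assms(3) by (metis inj_onI)
  moreover have "countable (f ` A)"
    using f assms(1) by (meson countable_subset image_subsetI)
  ultimately show ?thesis
    by (rule countable_image_inj_on[rotated])
qed

lemma countable_eventually_const:
  "countable {w :: nat \<Rightarrow> 'a::countable. \<exists>N. \<forall>i\<ge>N. w i = w N}"
proof (rule countable_if_determined[where K = UNIV and R = "\<lambda>w (u, y). (\<forall>i<length u. w i = u ! i) \<and> (\<forall>i\<ge>length u. w i = y)"])
  show "countable (UNIV :: ('a list \<times> 'a) set)"
    by simp
next
  fix w :: "nat \<Rightarrow> 'a" assume "w \<in> {w. \<exists>N. \<forall>i\<ge>N. w i = w N}"
  then obtain N y where "\<forall>i\<ge>N. w i = y" by blast
  then show "\<exists>k\<in>UNIV. (\<lambda>(u, y). (\<forall>i<length u. w i = u ! i) \<and> (\<forall>i\<ge>length u. w i = y)) k"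
    by (intro bexI[of _ "(map w [0..<N], y)"]) simp_all
next
  fix a b :: "nat \<Rightarrow> 'a" and k
  assume "(\<lambda>(u, y). (\<forall>i<length u. a i = u ! i) \<and> (\<forall>i\<ge>length u. a i = y)) k"
    "(\<lambda>(u, y). (\<forall>i<length u. b i = u ! i) \<and> (\<forall>i\<ge>length u. b i = y)) k"
  moreover obtain u y where "k = (u, y)"
    by fastforce
  ultimately have *: "\<And>i. i < length u \<Longrightarrow> a i = u ! i \<and> b i = u ! i" "\<And>i. length u \<le> i \<Longrightarrow> a i = y \<and> b i = y"
    by auto
  show "a = b"
  proof
    show "a i = b i" for i
      using *[of i] by (cases "i < length u") auto
  qed
qed

context
  fixes L N :: nat and w :: "nat \<Rightarrow> bool"
  assumes LN: "L < N" and markov: "\<And>i. N \<le> i \<Longrightarrow> w i \<noteq> w (i + 1) \<Longrightarrow> markov_at L w i"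
begin

text \<open>With y the other letter, the excluded factor is x (xy)^k y. Markov's condition at the
  last place where x is followed by y produces a factor y (yx)^m x with m < k, beginning at the
  first letter of the closing yy: infinite descent.\<close>

lemma no_alternating_block:
  assumes "1 \<le> k" "N \<le> i" "w i = x" "\<And>t. t < 2 * k \<Longrightarrow> w (i + 1 + t) = (x = even t)"
    "w (i + 2 * k + 1) = (\<not> x)"
  shows False
  using assms
proof (induction k arbitrary: i x rule: less_induct)
  case (less k)
  define c where "c = i + 2 * k - 1"
  have wc: "w c = x" "w (c + 1) = (\<not> x)"
  proof -
    have "c = i + 1 + (2 * k - 2)" "c + 1 = i + 1 + (2 * k - 1)"
      using \<open>1 \<le> k\<close> by (auto simp: c_def)
    moreover have "even (2 * k - 2)" "odd (2 * k - 1)"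
      using \<open>1 \<le> k\<close> by auto
    moreover have "2 * k - 2 < 2 * k" "2 * k - 1 < 2 * k"
      using \<open>1 \<le> k\<close> by auto
    ultimately show "w c = x" "w (c + 1) = (\<not> x)"
      using less.prems(4)[of "2 * k - 2"] less.prems(4)[of "2 * k - 1"] by simp_all
  qed
  have left: "w (c - 1 - t) = (x = odd t)" if "t + 2 < 2 * k" for t
  proof -
    have "c - 1 - t = i + 1 + (2 * k - 3 - t)"
      using that by (auto simp: c_def)
    moreover have "even (2 * k - 3 - t) = odd t"
      using that by presburger
    ultimately show ?thesis
      using less.prems(4)[of "2 * k - 3 - t"] that by auto
  qed
  have lefti: "c - 1 - (2 * k - 2) = i"
    using \<open>1 \<le> k\<close> by (auto simp: c_def)
  have c2: "w (c + 2) = (\<not> x)"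
    using less.prems(5) \<open>1 \<le> k\<close> by (auto simp: c_def)
  have "markov_at L w c"
    by (rule markov) (use less.prems(1,2) wc in \<open>auto simp: c_def\<close>)
  then obtain j where j: "\<And>t. t < j \<Longrightarrow> w (c - 1 - t) = w (c + 2 + t)"
      "w (c - 1 - j) = (\<not> x)" "w (c + 2 + j) = x"
    unfolding markov_at_def using wc by blast
  have "j \<noteq> 0"
    using j(3) c2 by (metis add_0_right)
  \<comment> \<open>Up to the first difference \<open>j\<close> the right word copies the
    alternation yxyx... read to the left. If \<open>j\<close> falls inside the alternation it is
    even and m = j/2; otherwise the copy extends to the opening xx, and m = k - 1.\<close>
  have "\<exists>m. 1 \<le> m \<and> m < k \<and> 2 * m \<le> j \<and> w (c + 2 + 2 * m) = x"
  proof (cases "j \<le> 2 * k - 2")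
    case True
    have "j \<noteq> 2 * k - 2"
      using j(2) lefti less.prems(3) by auto
    with True have jk: "j + 2 < 2 * k" by auto
    have "even j"
      using left[OF jk] j(2) by auto
    then obtain m where "j = 2 * m" by auto
    then show ?thesis
      using jk j \<open>j \<noteq> 0\<close> by (intro exI[of _ m]) auto
  next
    case False
    have "k \<noteq> 1"
      using j(1)[of 0] False \<open>j \<noteq> 0\<close> lefti c2 less.prems(3) by auto
    with \<open>1 \<le> k\<close> have "2 \<le> k" by auto
    have "w (c + 2 + (2 * k - 2)) = x"
      using j(1)[of "2 * k - 2"] False lefti less.prems(3) by auto
    moreover have "2 * k - 2 = 2 * (k - 1)" by auto
    ultimately show ?thesis
      using False \<open>2 \<le> k\<close> by (intro exI[of _ "k - 1"]) auto
  qed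
  then obtain m where m: "1 \<le> m" "m < k" "2 * m \<le> j" "w (c + 2 + 2 * m) = x" by auto
  have c1: "c + 1 = i + 2 * k"
    using \<open>1 \<le> k\<close> by (auto simp: c_def)
  show False
  proof (rule less.IH[OF m(2,1), of "c + 1" "\<not> x"])
    fix t assume t: "t < 2 * m"
    have "w (c - 1 - t) = w (c + 2 + t)" "w (c - 1 - t) = (x = odd t)"
      using j(1)[of t] left[of t] t m by auto
    then show "w (c + 1 + 1 + t) = ((\<not> x) = even t)"
      by auto
  next
    show "N \<le> c + 1"
      using c1 less.prems(2) by simp
    show "w (c + 1) = (\<not> x)"
      by (rule wc)
    have "c + 1 + 2 * m + 1 = c + 2 + 2 * m"
      by simp
    then show "w (c + 1 + 2 * m + 1) = (\<not> \<not> x)"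
      using m(4) by metis
  qed
qed

text \<open>Suppose xx occurs and yy occurs later. Between the first such yy and the last repetition
  before it, which must be xx, the letters alternate, and this is the factor just excluded.\<close>

lemma eventually_one_letter_isolated: "\<exists>y. \<exists>M\<ge>N. \<forall>n\<ge>M. \<not> (w n = y \<and> w (n + 1) = y)"
proof (cases "\<exists>i\<ge>N. w i = w (i + 1)")
  case False
  then show ?thesis by blast
next
  case True
  then obtain i where i: "N \<le> i" "w i = w (i + 1)" by auto
  define x where "x = w i"
  have "\<not> (w j = (\<not> x) \<and> w (j + 1) = (\<not> x))" if "i \<le> j" for j
  proof
    assume *: "w j = (\<not> x) \<and> w (j + 1) = (\<not> x)"
    define j0 where "j0 = (LEAST j. i \<le> j \<and> w j = (\<not> x) \<and> w (j + 1) = (\<not> x))"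
    have j0: "i \<le> j0" "w j0 = (\<not> x)" "w (j0 + 1) = (\<not> x)"
      using LeastI[of "\<lambda>j. i \<le> j \<and> w j = (\<not> x) \<and> w (j + 1) = (\<not> x)" j] * that
      by (auto simp: j0_def)
    have least: "\<not> (i \<le> j' \<and> w j' = (\<not> x) \<and> w (j' + 1) = (\<not> x))" if "j' < j0" for j'
      using not_less_Least that unfolding j0_def by blast
    define S where "S = {i'. i \<le> i' \<and> i' < j0 \<and> w i' = w (i' + 1)}"
    have "i < j0"
      using j0 x_def i by (cases "i = j0") auto
    then have S: "finite S" "i \<in> S"
      using i by (auto simp: S_def)
    define i' where "i' = Max S"
    have "i' \<in> S"
      unfolding i'_def using S by (intro Max_in) auto
    then have i': "i \<le> i'" "i' < j0" "w i' = w (i' + 1)"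
      by (auto simp: S_def)
    have wi': "w i' = x"
      using least[of i'] i' by auto
    have alt: "w n \<noteq> w (n + 1)" if "i' < n" "n < j0" for n
      using Max_ge[OF S(1), of n] that i' unfolding i'_def[symmetric] by (auto simp: S_def)
    have form: "w (i' + 1 + t) = (x = even t)" if "i' + 1 + t \<le> j0" for t
      using that
    proof (induction t)
      case 0
      then show ?case using wi' i' by auto
    next
      case (Suc t)
      then show ?case using alt[of "i' + 1 + t"] by auto
    qed
    define e where "e = j0 - i' - 1"
    have "odd e"
      using form[of e] j0 i' by (auto simp: e_def)
    then obtain k' where k': "e = 2 * k' + 1" by (auto elim: oddE)
    show False
    proof (rule no_alternating_block[of "k' + 1" i' x])
      fix t assume "t < 2 * (k' + 1)"
      then show "w (i' + 1 + t) = (x = even t)"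
        using form[of t] i' k' by (auto simp: e_def)
    next
      have "i' + 2 * (k' + 1) + 1 = j0 + 1"
        using k' i' by (auto simp: e_def)
      then show "w (i' + 2 * (k' + 1) + 1) = (\<not> x)"
        using j0 by metis
    qed (use i i' wi' in auto)
  qed
  then show ?thesis
    using i by (intro exI[of _ "\<not> x"] exI[of _ i]) auto
qed

end

text \<open>If the letter \<open>y\<close> is isolated, the word is a concatenation of the blocks \<open>x\<close> and \<open>xy\<close>;
  \<open>block_pos\<close> gives the position of a block, and the letter following a block start tells
  which block it is.\<close>

fun block_pos :: "bool \<Rightarrow> nat \<Rightarrow> (nat \<Rightarrow> bool) \<Rightarrow> nat \<Rightarrow> nat" where
  "block_pos y M v 0 = M"
| "block_pos y M v (Suc n) = block_pos y M v n + (if v n = y then 2 else 1)"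

lemma block_pos_ge: "M + n \<le> block_pos y M v n"
  by (induction n) auto

definition desubstitutes :: "bool \<Rightarrow> nat \<Rightarrow> (nat \<Rightarrow> bool) \<Rightarrow> (nat \<Rightarrow> bool) \<Rightarrow> bool" where
  "desubstitutes y M v w \<longleftrightarrow> (\<forall>n. w (block_pos y M v n) = (\<not> y) \<and> w (block_pos y M v n + 1) = v n)"

lemma ex_desubstitution:
  assumes "\<And>n. M \<le> n \<Longrightarrow> \<not> (w n = y \<and> w (n + 1) = y)" "w M = (\<not> y)"
  shows "\<exists>v. desubstitutes y M v w"
proof -
  \<comment> \<open>The block starts are first read off \<open>w\<close>, since
    \<open>block_pos\<close> refers to the word \<open>v\<close> still under construction.\<close>
  define g where "g = rec_nat M (\<lambda>_ m. m + (if w (m + 1) = y then 2 else 1))"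
  define v where "v n = w (g n + 1)" for n
  have g: "g 0 = M" "g (Suc n) = g n + (if w (g n + 1) = y then 2 else 1)" for n
    by (auto simp: g_def)
  have gv: "block_pos y M v n = g n" for n
    by (induction n) (auto simp: g v_def)
  have "M \<le> g n \<and> w (g n) = (\<not> y)" for n
    by (induction n) (use assms in \<open>auto simp: g\<close>, metis Suc_eq_plus1 assms(1) le_SucI)
  then have "desubstitutes y M v w"
    unfolding desubstitutes_def gv by (simp add: v_def)
  then show ?thesis by blast
qed

lemma desubstitutes_determines:
  assumes "desubstitutes y M v w1" "desubstitutes y M v w2" "M \<le> i"
  shows "w1 i = w2 i"
proof -
  have "\<forall>i<block_pos y M v n. M \<le> i \<longrightarrow> w1 i = w2 i" for n
  proof (induction n)
    case (Suc n)
    show ?case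
    proof (intro allI impI)
      fix i assume i: "i < block_pos y M v (Suc n)" "M \<le> i"
      then consider "i < block_pos y M v n" | "i = block_pos y M v n" | "i = block_pos y M v n + 1"
        unfolding block_pos.simps by (cases "v n = y") (auto, linarith+)
      then show "w1 i = w2 i"
        using Suc i assms by cases (auto simp: desubstitutes_def)
    qed
  qed auto
  moreover have "i < block_pos y M v (Suc i)"
    using block_pos_ge[of M "Suc i" y v] by auto
  ultimately show ?thesis
    using assms(3) by blast
qed

text \<open>Read backwards, the blocks x and xy become x and yx, and x(yx) = (xy)x. Therefore m
  common letters of \<open>v\<close>, whose blocks have total length D \<ge> m, give D + 1 common
  letters of \<open>w\<close>, and the first difference in \<open>v\<close> at m shows up in
  \<open>w\<close> at D + 1. This additional letter is what lowers \<open>Suc L\<close> to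
  \<open>L\<close>.\<close>

lemma markov_word_desubstitute:
  assumes "markov_word (Suc L) w" "desubstitutes y M v w"
  shows "markov_word L v"
proof -
  define g where "g = block_pos y M v"
  have g_Suc: "g (Suc n) = g n + (if v n = y then 2 else 1)" for n
    by (simp add: g_def)
  have g_ge: "n \<le> g n" for n
    using block_pos_ge[of M n y v] by (simp add: g_def)
  have wg: "w (g n) = (\<not> y)" "w (g n + 1) = v n" for n
    using assms(2) by (auto simp: desubstitutes_def g_def)
  from assms(1) obtain N where N: "Suc L < N" "\<And>i. N \<le> i \<Longrightarrow> w i \<noteq> w (i + 1) \<Longrightarrow> markov_at (Suc L) w i"
    by (auto simp: markov_word_def)
  have agree: "\<exists>D\<ge>m. g (n + 2 + m) = g (n + 2) + D \<and> g n = g (n - m) + D \<and>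
      (\<forall>k\<le>D. w (g n - k) = w (g (n + 2) + k))"
    if "m \<le> n" "\<And>k. k < m \<Longrightarrow> v (n - 1 - k) = v (n + 2 + k)" for m n
    using that
  proof (induction m)
    case 0
    then show ?case using wg by auto
  next
    case (Suc m)
    then obtain D where D: "m \<le> D" "g (n + 2 + m) = g (n + 2) + D" "g n = g (n - m) + D"
      "\<And>k. k \<le> D \<Longrightarrow> w (g n - k) = w (g (n + 2) + k)" by auto
    define s where "s = (if v (n + 2 + m) = y then 2 else 1 :: nat)"
    have v: "v (n - Suc m) = v (n + 2 + m)"
      using Suc.prems(2)[of m] by auto
    have s1: "g (n + 2 + Suc m) = g (n + 2 + m) + s"
      using g_Suc[of "n + 2 + m"] by (simp add: s_def)
    have "Suc (n - Suc m) = n - m"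
      using Suc.prems(1) by auto
    then have s2: "g (n - m) = g (n - Suc m) + s"
      using g_Suc[of "n - Suc m"] v by (auto simp: s_def)
    have "w (g n - k) = w (g (n + 2) + k)" if k: "k \<le> D + s" for k
    proof -
      consider "k \<le> D" | "k = D + s" | "k = D + 1" "s = 2"
        using k by (fastforce simp: s_def split: if_splits)
      then show ?thesis
      proof cases
        case 2
        have "g n - k = g (n - Suc m)" "g (n + 2) + k = g (n + 2 + Suc m)"
          using s1 s2 D 2 by auto
        then show ?thesis using wg by metis
      next
        case 3
        have "g n - k = g (n - Suc m) + 1" "g (n + 2) + k = g (n + 2 + m) + 1"
          using s2 D 3 by auto
        then show ?thesis using wg v by metis
      qed (use D in auto)
    qed
    then show ?case
      using s1 s2 D by (intro exI[of _ "D + s"]) (auto simp: s_def)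
  qed
  have "markov_at L v n" if n: "N \<le> n" "v n \<noteq> v (n + 1)" for n
  proof -
    \<comment> \<open>Of the two blocks meeting at a change one is x and the other xy, three letters
      together; so both outward words of \<open>w\<close> begin at block starts, \<open>g n\<close>
      and \<open>g (n + 2)\<close>.\<close>
    define c where "c = g n + 1"
    have c: "w c = v n" "c - 1 = g n" "c + 2 = g (n + 2)"
      using n(2) wg(2)[of n] by (auto simp: c_def g_Suc)
    have c1: "w (c + 1) = v (n + 1)"
    proof (cases "v n = y")
      case True
      then have "c + 1 = g (n + 1)" by (auto simp: c_def g_Suc)
      then have "w (c + 1) = w (g (n + 1))" by simp
      then show ?thesis using wg(1)[of "n + 1"] True n by auto
    next
      case False
      then have "c + 1 = g (n + 1) + 1" by (auto simp: c_def g_Suc)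
      then show ?thesis using wg(2)[of "n + 1"] by metis
    qed
    have "markov_at (Suc L) w c"
      by (rule N) (use n g_ge[of n] c c1 in \<open>auto simp: c_def\<close>)
    then obtain j where j: "j \<le> L" "\<And>k. k < j \<Longrightarrow> w (g n - k) = w (g (n + 2) + k)"
        "w (g n - j) = v (n + 1)" "w (g (n + 2) + j) = v n"
      unfolding markov_at_def c(2) c(3) c(1) c1 less_Suc_eq_le by blast
    have differ: "w (g n - j) \<noteq> w (g (n + 2) + j)"
      using j n by auto
    \<comment> \<open>If \<open>v\<close> agreed for \<open>L\<close> letters, \<open>w\<close>
      would agree at all places up to \<open>L\<close>, and \<open>j\<close> is one of them.\<close>
    have ex: "\<exists>m. v (n - 1 - m) \<noteq> v (n + 2 + m) \<and> m < L"
    proof (rule ccontr)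
      assume "\<not> ?thesis"
      then have "\<And>m. m < L \<Longrightarrow> v (n - 1 - m) = v (n + 2 + m)" by auto
      moreover have "L \<le> n"
        using N(1) n(1) by auto
      ultimately obtain D where "L \<le> D" "\<forall>k\<le>D. w (g n - k) = w (g (n + 2) + k)"
        using agree[of L n] by blast
      then show False using j(1) differ by auto
    qed
    define m where "m = (LEAST m. v (n - 1 - m) \<noteq> v (n + 2 + m) \<and> m < L)"
    have m: "v (n - 1 - m) \<noteq> v (n + 2 + m)" "m < L"
      using LeastI_ex[OF ex] by (auto simp: m_def)
    have m': "v (n - 1 - k) = v (n + 2 + k)" if "k < m" for k
      using not_less_Least[of k "\<lambda>m. v (n - 1 - m) \<noteq> v (n + 2 + m) \<and> m < L"] that m(2)
      unfolding m_def[symmetric] by auto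
    have mn: "m < n"
      using m N n by auto
    obtain D where D: "m \<le> D" "g (n + 2 + m) = g (n + 2) + D" "g n = g (n - m) + D"
      "\<And>k. k \<le> D \<Longrightarrow> w (g n - k) = w (g (n + 2) + k)"
      using agree[of m n, OF _ m'] mn by auto
    have right: "w (g (n + 2) + (D + 1)) = v (n + 2 + m)"
      using wg(2)[of "n + 2 + m"] D by (auto simp: algebra_simps)
    have "Suc (n - 1 - m) = n - m"
      using mn by auto
    then have "g (n - m) = g (n - 1 - m) + (if v (n - 1 - m) = y then 2 else 1)"
      using g_Suc[of "n - 1 - m"] by auto
    then have "g n - (D + 1) = g (n - 1 - m) + (if v (n - 1 - m) = y then 1 else 0)"
      using D by auto
    then have left: "w (g n - (D + 1)) = v (n - 1 - m)"
      using wg[of "n - 1 - m"] by (auto split: if_splits)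
    have "j = D + 1"
    proof (rule antisym)
      show "j \<le> D + 1"
        using j(2)[of "D + 1"] left right m(1) by (meson not_le)
      show "D + 1 \<le> j"
        using D(4)[of j] differ by linarith
    qed
    then show ?thesis
      unfolding markov_at_def using m(2) m' left right j by (intro exI[of _ m]) auto
  qed
  then show ?thesis
    unfolding markov_word_def using N(1) by (intro exI[of _ N]) auto
qed

text \<open>For \<open>L = 0\<close> no change of letter is admissible from some place on. In the
  induction step a word is recovered from its isolated letter, a finite prefix and its
  desubstitution.\<close>

lemma countable_markov_words: "countable {w. markov_word L w}"
proof (induction L)
  case 0
  have "{w. markov_word 0 w} \<subseteq> {w. \<exists>N. \<forall>i\<ge>N. w i = w N}"
  proof safe
    fix w assume "markov_word 0 w"
    then obtain N where N: "\<And>i. N \<le> i \<Longrightarrow> w i = w (i + 1)"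
      unfolding markov_word_def markov_at_def by blast
    have "w i = w N" if "N \<le> i" for i
      using that
    proof (induction i rule: dec_induct)
      case (step i)
      then show ?case using N[of i] by simp
    qed simp
    then show "\<exists>N. \<forall>i\<ge>N. w i = w N" by auto
  qed
  then show ?case
    using countable_eventually_const countable_subset by blast
next
  case (Suc L)
  let ?A = "{w. markov_word (Suc L) w}" and ?C = "{w :: nat \<Rightarrow> bool. \<exists>N. \<forall>i\<ge>N. w i = w N}"
  have "countable (?A - ?C)"
  proof (rule countable_if_determined[where K = "(UNIV :: (bool \<times> bool list) set) \<times> {v. markov_word L v}" and
        R = "\<lambda>w ((y, u), v). (\<forall>i<length u. w i = u ! i) \<and> desubstitutes y (length u) v w"])
    show "countable ((UNIV :: (bool \<times> bool list) set) \<times> {v. markov_word L v})"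
      using Suc by blast
  next
    fix w assume w: "w \<in> ?A - ?C"
    then obtain N where N: "Suc L < N" "\<And>i. N \<le> i \<Longrightarrow> w i \<noteq> w (i + 1) \<Longrightarrow> markov_at (Suc L) w i"
      by (auto simp: markov_word_def)
    obtain y M0 where M0: "\<And>n. M0 \<le> n \<Longrightarrow> \<not> (w n = y \<and> w (n + 1) = y)"
      using eventually_one_letter_isolated[OF N] by metis
    obtain M where M: "M0 \<le> M" "w M = (\<not> y)"
      using M0[of M0] by (metis le_add1 order_refl)
    obtain v where "desubstitutes y M v w"
      using ex_desubstitution[of M w y] M0 M by (meson order_trans)
    moreover from this have "markov_word L v"
      using markov_word_desubstitute w by blast
    ultimately show "\<exists>k\<in>UNIV \<times> {v. markov_word L v}.
        (\<lambda>((y, u), v). (\<forall>i<length u. w i = u ! i) \<and> desubstitutes y (length u) v w) k"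
      by (intro bexI[of _ "((y, map w [0..<M]), v)"]) simp_all
  next
    fix a b :: "nat \<Rightarrow> bool" and k
    assume "(\<lambda>((y, u), v). (\<forall>i<length u. a i = u ! i) \<and> desubstitutes y (length u) v a) k"
      "(\<lambda>((y, u), v). (\<forall>i<length u. b i = u ! i) \<and> desubstitutes y (length u) v b) k"
    moreover obtain y u v where "k = ((y, u), v)"
      by (metis prod.exhaust)
    ultimately have *: "\<And>i. i < length u \<Longrightarrow> a i = b i"
      "desubstitutes y (length u) v a" "desubstitutes y (length u) v b"
      by auto
    show "a = b"
    proof
      show "a i = b i" for i
        using *(1)[of i] desubstitutes_determines[OF *(2,3), of i] by linarith
    qed
  qed
  then have "countable ((?A - ?C) \<union> ?C)"
    using countable_eventually_const[where 'a = bool] by (rule countable_Un)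
  then show ?case
    by (rule countable_subset[rotated]) blast
qed

section \<open>Continued fractions with approximation constant above one third\<close>

text \<open>\<open>r n\<close> stands for [0; d n, d (n+1), ...] and \<open>l n\<close> for the
  expansion read backwards from \<open>d (n-1)\<close>; the bounded sum is the reciprocal of q |q x
  - p| at a convergent p/q. The value \<open>l 0\<close> is left free in [0,1], so that the digits
  may start anywhere inside a longer expansion.\<close>

locale markov_digits =
  fixes d :: "nat \<Rightarrow> nat" and r l :: "nat \<Rightarrow> real" and \<delta> :: real
  assumes digit: "d n = 1 \<or> d n = 2"
    and r: "0 < r n" "r n < 1" "r n = 1 / (d n + r (n + 1))"
    and l: "0 \<le> l n" "l n \<le> 1" "l (n + 1) = 1 / (d n + l n)"
    and \<delta>: "0 < \<delta>" and bound: "d n + r (n + 1) + l n \<le> 3 - \<delta>"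
begin

lemma r1: "d n = 1 \<Longrightarrow> r n = 1 / (1 + r (n + 1))" "d n = 1 \<Longrightarrow> 1 / 2 < r n"
  and r2: "d n = 2 \<Longrightarrow> r n = 1 / (2 + r (n + 1))" "d n = 2 \<Longrightarrow> r n < 1 / 2"
  using r(1,2)[of "n + 1"] by (subst r(3); simp add: field_simps)+

lemma l1: "d n = 1 \<Longrightarrow> l (n + 1) = 1 / (1 + l n)" "d n = 1 \<Longrightarrow> 1 / 2 \<le> l (n + 1)"
  and l2: "d n = 2 \<Longrightarrow> l (n + 1) = 1 / (2 + l n)" "d n = 2 \<Longrightarrow> 1 / 3 \<le> l (n + 1)" "d n = 2 \<Longrightarrow> l (n + 1) \<le> 1 / 2"
  using l(1,2)[of n] by (subst l(3); simp add: field_simps)+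

lemma iterate_1: "0 \<le> t \<Longrightarrow> 1 / (1 + 1 / (1 + t)) = 1 - 1 / (2 + t)" for t :: real
  by (simp add: field_simps)

lemma r11: "d n = 1 \<Longrightarrow> d (n + 1) = 1 \<Longrightarrow> r n = 1 - 1 / (2 + r (n + 2))"
  and r22: "d n = 2 \<Longrightarrow> d (n + 1) = 2 \<Longrightarrow> r n = 1 / (2 + 1 / (2 + r (n + 2)))"
  using r1(1)[of n] r1(1)[of "n + 1"] r2(1)[of n] r2(1)[of "n + 1"]
    iterate_1[of "r (n + 2)"] r(1)[of "n + 2"] by auto

lemma l11: "d n = 1 \<Longrightarrow> d (n + 1) = 1 \<Longrightarrow> l (n + 2) = 1 - 1 / (2 + l n)"
  and l22: "d n = 2 \<Longrightarrow> d (n + 1) = 2 \<Longrightarrow> l (n + 2) = 1 / (2 + 1 / (2 + l n))"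
  using l1(1)[of n] l1(1)[of "n + 1"] l2(1)[of n] l2(1)[of "n + 1"] iterate_1[of "l n"] l(1)[of n]
  by auto

text \<open>Otherwise the value at the 2 would exceed 2 + 1/2 + 1/2.\<close>

lemma not_1_2_1: "d n = 1 \<Longrightarrow> d (n + 1) = 2 \<Longrightarrow> d (n + 2) = 2"
  using digit[of "n + 2"] r1(2)[of "n + 2"] l1(2)[of n] bound[of "n + 1"] \<delta> by auto

text \<open>Otherwise the value at the first 2 would exceed 2 + 2/3 + 1/3. The index starts at
  \<open>n + 1\<close> because the bound 1/3 on \<open>l\<close> requires a preceding digit.\<close>

lemma not_2_1_2:
  assumes "d (n + 1) = 2" "d (n + 2) = 1"
  shows "d (n + 3) = 1"
proof (rule ccontr)
  assume "d (n + 3) \<noteq> 1"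
  then have "r (n + 3) < 1 / 2"
    using digit[of "n + 3"] r2(2) by auto
  then have "r (n + 2) > 2 / 3"
    using r1(1)[of "n + 2"] assms r(1)[of "n + 3"] by (simp add: numeral_eq_Suc) (simp add: field_simps)
  moreover have "l (n + 1) \<ge> 1 / 3"
    using digit[of n] l1(2)[of n] l2(2)[of n] by auto
  ultimately show False
    using bound[of "n + 1"] assms \<delta> by auto
qed

lemma diff_inverse_gap:
  fixes a b :: real
  assumes "0 \<le> a" "0 \<le> b" "1 / (2 + a) \<le> 1 / (2 + b) - \<delta>"
  shows "b + 4 * \<delta> \<le> a"
proof -
  have cancel: "(1 / v - 1 / u) * (u * v) = u - v" if "0 < u" "0 < v" for u v :: real
    using that by (simp add: field_simps)
  have "\<delta> * ((2 + a) * (2 + b)) \<le> (1 / (2 + b) - 1 / (2 + a)) * ((2 + a) * (2 + b))"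
    using assms by (intro mult_right_mono) auto
  also have "\<dots> = a - b"
    using cancel[of "2 + a" "2 + b"] assms by simp
  finally have *: "\<delta> * ((2 + a) * (2 + b)) \<le> a - b" .
  have "2 * 2 \<le> (2 + a) * (2 + b)"
    using assms by (intro mult_mono) auto
  then have "\<delta> * 4 \<le> \<delta> * ((2 + a) * (2 + b))"
    using \<delta> by (intro mult_left_mono) auto
  with * show ?thesis by auto
qed

text \<open>The identity \<open>[0;1,1,X] + [0;2,X] = 1\<close> turns the bound into a comparison of the
  two expansions read outwards from a place where the digit changes.\<close>

lemma gap_at_2_1:
  assumes "d n = 2" "d (n + 1) = 2" "d (n + 2) = 1" "d (n + 3) = 1"
  shows "r (n + 4) + 4 * \<delta> \<le> l n"
proof -
  have "1 / (2 + l n) \<le> 1 / (2 + r (n + 4)) - \<delta>"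
    using bound[of "n + 1"] l2(1)[of n] r11[of "n + 2"] assms by (simp add: numeral_eq_Suc)
  then show ?thesis
    using diff_inverse_gap l(1) r(1) by (meson less_imp_le)
qed

lemma gap_at_1_2:
  assumes "d n = 1" "d (n + 1) = 1" "d (n + 2) = 2" "d (n + 3) = 2"
  shows "l n + 4 * \<delta> \<le> r (n + 4)"
proof -
  have "1 / (2 + r (n + 4)) \<le> 1 / (2 + l n) - \<delta>"
    using bound[of "n + 2"] l11[of n] r2(1)[of "n + 3"] assms by (simp add: numeral_eq_Suc)
  then show ?thesis
    using diff_inverse_gap l(1) r(1) by (meson less_imp_le)
qed

text \<open>\<open>l (n + 2 * i + 2)\<close> begins with 2i + 1 twos and then a 1. Since [0;2,2,X]
  increases with X, the comparison can drop two digits at a time; at the last single 2 the value 2/5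
  separates [0;2,1,...] from [0;2,2,...].\<close>

lemma shorter_odd_run_2:
  assumes "d n = 1" "\<And>t. t \<le> 2 * i \<Longrightarrow> d (n + 1 + t) = 2" "r m \<le> l (n + 2 * i + 2)"
  shows "\<exists>j\<le>i. (\<forall>t\<le>2*j. d (m + t) = 2) \<and> d (m + 2 * j + 1) = 1"
  using assms(2,3)
proof (induction i arbitrary: m)
  case 0
  have n1: "d (n + 1) = 2" using 0(1)[of 0] by simp
  have l2': "l (n + 2) \<le> 2 / 5"
    using l1(2)[of n] l2(1)[of "n + 1"] assms(1) n1 l(1)[of "n + 1"]
    by (simp add: numeral_eq_Suc) (simp add: field_simps)
  then have m: "d m = 2"
    using digit[of m] r1(2)[of m] 0 by auto
  have "d (m + 1) \<noteq> 2"
  proof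
    assume "d (m + 1) = 2"
    then have "r (m + 1) < 1 / 2" by (rule r2)
    then have "r m > 2 / 5"
      unfolding r2(1)[OF m] using r(1)[of "m + 1"] by (simp add: field_simps)
    then show False using l2' 0 by auto
  qed
  then show ?case
    using m digit[of "m + 1"] by auto
next
  case (Suc i)
  have ds: "d (n + 2 * i + 2) = 2" "d (n + 2 * i + 3) = 2"
    using Suc.prems(1)[of "2 * i + 1"] Suc.prems(1)[of "2 * i + 2"] by (auto simp: numeral_eq_Suc)
  then have l22': "l (n + 2 * Suc i + 2) = 1 / (2 + 1 / (2 + l (n + 2 * i + 2)))"
    using l22[of "n + 2 * i + 2"] by (simp add: numeral_eq_Suc)
  have "l (n + 2 * Suc i + 2) \<le> 1 / 2"
    using l2(3)[of "n + 2 * i + 3"] ds by (simp add: numeral_eq_Suc)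
  then have m: "d m = 2"
    using digit[of m] r1(2)[of m] Suc.prems by auto
  show ?case
  proof (cases "d (m + 1) = 2")
    case True
    have "r (m + 2) \<le> l (n + 2 * i + 2)"
      using Suc.prems(2) unfolding l22' r22[OF m True] using r(1)[of "m + 2"] l(1)[of "n + 2 * i + 2"]
      by (simp add: field_simps)
    then obtain j where j: "j \<le> i" "\<forall>t\<le>2*j. d (m + 2 + t) = 2" "d (m + 2 + 2 * j + 1) = 1"
      using Suc.IH[of "m + 2"] Suc.prems(1) by auto
    have "d (m + t) = 2" if "t \<le> 2 * Suc j" for t
    proof -
      consider "t = 0" | "t = 1" | s where "t = s + 2"
        by (metis One_nat_def Suc_pred add.commute add_2_eq_Suc' bot_nat_0.not_eq_extremum not0_implies_Suc)
      then show ?thesis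
        using m True j(2) that by cases (auto simp: add.commute add.left_commute)
    qed
    then show ?thesis
      using j by (intro exI[of _ "Suc j"]) (auto simp: add.commute add.left_commute)
  next
    case False
    then show ?thesis
      using m digit[of "m + 1"] by (intro exI[of _ 0]) auto
  qed
qed

text \<open>The same with the inequality reversed: [0;1,1,X] increases as well, and 2/3 separates
  [0;1,2,...] from [0;1,1,...].\<close>

lemma shorter_odd_run_1:
  assumes "d n = 2" "\<And>t. t \<le> 2 * i \<Longrightarrow> d (n + 1 + t) = 1" "l (n + 2 * i + 2) \<le> r m"
  shows "\<exists>j\<le>i. (\<forall>t\<le>2*j. d (m + t) = 1) \<and> d (m + 2 * j + 1) = 2"
  using assms(2,3)
proof (induction i arbitrary: m)
  case 0
  have n1: "d (n + 1) = 1" using 0(1)[of 0] by simp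
  have l2': "l (n + 2) \<ge> 2 / 3"
    using l2(3)[of n] l1(1)[of "n + 1"] assms(1) n1 l(1)[of "n + 1"]
    by (simp add: numeral_eq_Suc) (simp add: field_simps)
  then have m: "d m = 1"
    using digit[of m] r2(2)[of m] 0 by auto
  have "d (m + 1) \<noteq> 1"
  proof
    assume "d (m + 1) = 1"
    then have "r (m + 1) > 1 / 2" by (rule r1)
    then have "r m < 2 / 3"
      unfolding r1(1)[OF m] using r(1)[of "m + 1"] by (simp add: field_simps)
    then show False using l2' 0 by auto
  qed
  then show ?case
    using m digit[of "m + 1"] by auto
next
  case (Suc i)
  have ds: "d (n + 2 * i + 2) = 1" "d (n + 2 * i + 3) = 1"
    using Suc.prems(1)[of "2 * i + 1"] Suc.prems(1)[of "2 * i + 2"] by (auto simp: numeral_eq_Suc)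
  then have l11': "l (n + 2 * Suc i + 2) = 1 - 1 / (2 + l (n + 2 * i + 2))"
    using l11[of "n + 2 * i + 2"] by (simp add: numeral_eq_Suc)
  have "l (n + 2 * Suc i + 2) \<ge> 1 / 2"
    using l1(2)[of "n + 2 * i + 3"] ds by (simp add: numeral_eq_Suc)
  then have m: "d m = 1"
    using digit[of m] r2(2)[of m] Suc.prems by auto
  show ?case
  proof (cases "d (m + 1) = 1")
    case True
    have "l (n + 2 * i + 2) \<le> r (m + 2)"
      using Suc.prems(2) unfolding l11' r11[OF m True] using r(1)[of "m + 2"] l(1)[of "n + 2 * i + 2"]
      by (simp add: field_simps)
    then obtain j where j: "j \<le> i" "\<forall>t\<le>2*j. d (m + 2 + t) = 1" "d (m + 2 + 2 * j + 1) = 2"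
      using Suc.IH[of "m + 2"] Suc.prems(1) by auto
    have "d (m + t) = 1" if "t \<le> 2 * Suc j" for t
    proof -
      consider "t = 0" | "t = 1" | s where "t = s + 2"
        by (metis One_nat_def Suc_pred add.commute add_2_eq_Suc' bot_nat_0.not_eq_extremum not0_implies_Suc)
      then show ?thesis
        using m True j(2) that by cases (auto simp: add.commute add.left_commute)
    qed
    then show ?thesis
      using j by (intro exI[of _ "Suc j"]) (auto simp: add.commute add.left_commute)
  next
    case False
    then show ?thesis
      using m digit[of "m + 1"] by (intro exI[of _ 0]) auto
  qed
qed

text \<open>Descent on the length. The run ends in 2,2 and is followed by 1,1, so the bound compares
  the digits after 1,1 with the rest of the run read backwards; hence a shorter odd run of twos
  follows. A single 2 is excluded by \<open>not_1_2_1\<close>.\<close>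

lemma no_odd_run_2:
  assumes "d n = 1" "\<And>t. t \<le> 2 * k \<Longrightarrow> d (n + 1 + t) = 2" "d (n + 2 * k + 2) = 1"
  shows False
  using assms
proof (induction k arbitrary: n rule: less_induct)
  case (less k)
  have "k \<noteq> 0"
    using not_1_2_1[of n] less.prems(1,3) less.prems(2)[of 0] by (cases "k = 0") auto
  then obtain i where k: "k = Suc i" by (cases k) auto
  have ds: "d (n + 2 * i + 2) = 2" "d (n + 2 * i + 3) = 2" "d (n + 2 * i + 4) = 1"
    using less.prems(2)[of "2 * i + 1"] less.prems(2)[of "2 * i + 2"] less.prems(3)
    by (auto simp: numeral_eq_Suc k)
  moreover have d5: "d (n + 2 * i + 5) = 1"
    using not_2_1_2[of "n + 2 * i + 2"] ds by (simp add: numeral_eq_Suc)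
  ultimately have "r (n + 2 * i + 6) \<le> l (n + 2 * i + 2)"
    using gap_at_2_1[of "n + 2 * i + 2"] \<delta> by (simp add: numeral_eq_Suc)
  then obtain j where j: "j \<le> i" "\<forall>t\<le>2*j. d (n + 2 * i + 6 + t) = 2" "d (n + 2 * i + 6 + 2 * j + 1) = 1"
    using shorter_odd_run_2[of n i "n + 2 * i + 6"] less.prems(1,2) by (fastforce simp: k)
  show False
    by (rule less.IH[of j "n + 2 * i + 5"]) (use j d5 k in \<open>auto simp: numeral_eq_Suc\<close>)
qed

lemma no_odd_run_1:
  assumes "d n = 2" "\<And>t. t \<le> 2 * k \<Longrightarrow> d (n + 1 + t) = 1" "d (n + 2 * k + 2) = 2" "1 \<le> n"
  shows False
  using assms
proof (induction k arbitrary: n rule: less_induct)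
  case (less k)
  have "k \<noteq> 0"
    using not_2_1_2[of "n - 1"] less.prems(1,3,4) less.prems(2)[of 0] by (cases "k = 0") auto
  then obtain i where k: "k = Suc i" by (cases k) auto
  have ds: "d (n + 2 * i + 2) = 1" "d (n + 2 * i + 3) = 1" "d (n + 2 * i + 4) = 2"
    using less.prems(2)[of "2 * i + 1"] less.prems(2)[of "2 * i + 2"] less.prems(3)
    by (auto simp: numeral_eq_Suc k)
  moreover have d5: "d (n + 2 * i + 5) = 2"
    using not_1_2_1[of "n + 2 * i + 3"] ds by (simp add: numeral_eq_Suc)
  ultimately have "l (n + 2 * i + 2) \<le> r (n + 2 * i + 6)"
    using gap_at_1_2[of "n + 2 * i + 2"] \<delta> by (simp add: numeral_eq_Suc)
  then obtain j where j: "j \<le> i" "\<forall>t\<le>2*j. d (n + 2 * i + 6 + t) = 1" "d (n + 2 * i + 6 + 2 * j + 1) = 2"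
    using shorter_odd_run_1[of n i "n + 2 * i + 6"] less.prems(1,2) by (fastforce simp: k)
  show False
    by (rule less.IH[of j "n + 2 * i + 5"]) (use j d5 k in \<open>auto simp: numeral_eq_Suc\<close>)
qed

lemma no_odd_run:
  assumes "1 \<le> n" "d n \<noteq> d (n + 1)" "\<And>t. t \<le> 2 * k \<Longrightarrow> d (n + 1 + t) = d (n + 1)"
    "d (n + 2 * k + 2) \<noteq> d (n + 1)"
  shows False
proof (cases "d n = 1")
  case True
  then have *: "d (n + 1) = 2" "d (n + 2 * k + 2) = 1"
    using assms digit[of "n + 1"] digit[of "n + 2 * k + 2"] by auto
  show ?thesis
    by (rule no_odd_run_2[of n k]) (use * True assms(3) in auto)
next
  case False
  then have *: "d n = 2" "d (n + 1) = 1" "d (n + 2 * k + 2) = 2"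
    using assms digit[of "n + 1"] digit[of n] digit[of "n + 2 * k + 2"] by auto
  show ?thesis
    by (rule no_odd_run_1[of n k]) (use * assms(1,3) in auto)
qed

text \<open>The first broken pair would end a run of equal digits that began at a pair boundary,
  hence a run of odd length.\<close>

lemma digits_paired:
  assumes "1 \<le> n" "d n \<noteq> d (n + 1)"
  shows "d (n + 1 + 2 * i) = d (n + 1 + 2 * i + 1)"
proof (induction i rule: less_induct)
  case (less i)
  show ?case
  proof (rule ccontr)
    assume *: "d (n + 1 + 2 * i) \<noteq> d (n + 1 + 2 * i + 1)"
    \<comment> \<open>The pair boundaries at which the digit changes; the run in question starts at
      the last of them.\<close>
    define S where "S = {i'. i' \<le> i \<and> d (n + 2 * i') \<noteq> d (n + 2 * i' + 1)}"
    have S: "finite S" "0 \<in> S"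
      using assms by (auto simp: S_def)
    define i' where "i' = Max S"
    have "i' \<in> S"
      unfolding i'_def using S by (intro Max_in) auto
    then have i': "i' \<le> i" "d (n + 2 * i') \<noteq> d (n + 2 * i' + 1)"
      by (auto simp: S_def)
    have after: "d (n + 2 * j) = d (n + 2 * j + 1)" if "i' < j" "j \<le> i" for j
      using Max_ge[OF S(1), of j] that i' unfolding i'_def[symmetric] by (auto simp: S_def)
    have const: "d (n + 2 * i' + 1 + t) = d (n + 2 * i' + 1)" if "t \<le> 2 * (i - i')" for t
      using that
    proof (induction t)
      case (Suc t)
      have "d (n + 2 * i' + 1 + t) = d (n + 2 * i' + 1 + Suc t)"
      proof (cases "even t")
        case True
        then obtain u where u: "t = 2 * u" by auto
        then have "i' + u < i" using Suc.prems by auto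
        then show ?thesis
          using less.IH[of "i' + u"] u by (simp add: algebra_simps)
      next
        case False
        then obtain u where u: "t = 2 * u + 1" by (auto elim: oddE)
        then have "i' + u + 1 \<le> i" using Suc.prems by auto
        then show ?thesis
          using after[of "i' + u + 1"] u by (simp add: algebra_simps)
      qed
      then show ?case using Suc by auto
    qed auto
    show False
    proof (rule no_odd_run[of "n + 2 * i'" "i - i'"])
      have e: "n + 2 * i' + 1 + 2 * (i - i') = n + 1 + 2 * i" "n + 2 * i' + 2 * (i - i') + 2 = n + 1 + 2 * i + 1"
        using i' by auto
      show "d (n + 2 * i' + 2 * (i - i') + 2) \<noteq> d (n + 2 * i' + 1)"
        using * const[of "2 * (i - i')"] unfolding e by simp
    qed (use assms i' const in auto)
  qed
qed

text \<open>The maps taking X to [0;1,1,X] and to [0;2,2,X] are increasing on [0,1], the values of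
  the first lie above those of the second, and both contract by 4. So the expansions are ordered
  like their words of pairs, lexicographically, and a difference above 4^(-L) is decided within
  \<open>L\<close> letters.\<close>

lemma markov_word_pairs:
  assumes "1 \<le> n" "d n \<noteq> d (n + 1)"
  shows "\<exists>L. markov_word L (\<lambda>i. d (n + 1 + 2 * i) = 1)"
proof -
  define w where "w i = (d (n + 1 + 2 * i) = 1)" for i
  define R where "R i = r (n + 1 + 2 * i)" for i
  define Q where "Q i = l (n + 1 + 2 * i)" for i
  have w1: "d (n + 1 + 2 * i) = 1" "d (n + 1 + 2 * i + 1) = 1" if "w i" for i
    using that digits_paired[OF assms, of i] unfolding w_def by metis+
  have w2: "d (n + 1 + 2 * i) = 2" "d (n + 1 + 2 * i + 1) = 2" if "\<not> w i" for i
    using that digits_paired[OF assms, of i] digit[of "n + 1 + 2 * i"] by (auto simp: w_def)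
  define f where "f b t = (if b then 1 - 1 / (2 + t) else 1 / (2 + 1 / (2 + t)))" for b :: bool and t :: real
  have R01: "0 \<le> R i" "R i \<le> 1" and Q01: "0 \<le> Q i" "Q i \<le> 1" for i
    using r(1,2)[of "n + 1 + 2 * i"] l(1,2) by (auto simp: R_def Q_def)
  have R: "R i = f (w i) (R (Suc i))" for i
    using w1[of i] w2[of i] r11[of "n + 1 + 2 * i"] r22[of "n + 1 + 2 * i"]
    by (auto simp: R_def f_def)
  have Q: "Q (Suc i) = f (w i) (Q i)" for i
    using w1[of i] w2[of i] l11[of "n + 1 + 2 * i"] l22[of "n + 1 + 2 * i"]
    by (auto simp: Q_def f_def)
  have f_less: "f False s < f True t" if "0 \<le> s" "s \<le> 1" "0 \<le> t" "t \<le> 1" for s t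
  proof -
    have "f False s < 1 / 2" "1 / 2 \<le> f True t"
      using that by (auto simp: f_def field_simps)
    then show ?thesis by simp
  qed
  have f_mono: "(f b s < f b t) = (s < t)" if "0 \<le> s" "0 \<le> t" for b s t
    using that by (auto simp: f_def field_simps)
  have f_contr: "4 * \<bar>f b s - f b t\<bar> \<le> \<bar>s - t\<bar>" if "0 \<le> s" "0 \<le> t" for b s t
  proof -
    \<comment> \<open>Both maps are fractional linear of determinant 1, with denominators 2 + X and
      5 + 2X.\<close>
    define c where "c = (if b then (2 + s) * (2 + t) else (5 + 2 * s) * (5 + 2 * t))"
    have "f b s - f b t = (s - t) / c"
      using that by (auto simp: f_def c_def divide_simps) (auto simp: algebra_simps)
    moreover have "4 \<le> c"
      using that by (auto simp: c_def algebra_simps)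
    ultimately have "\<bar>f b s - f b t\<bar> = \<bar>s - t\<bar> / c" by simp
    also have "\<dots> \<le> \<bar>s - t\<bar> / 4"
      using \<open>4 \<le> c\<close> by (intro divide_left_mono) auto
    finally show ?thesis by simp
  qed
  have compare: "\<exists>j<L. (\<forall>k<j. w (i - 1 - k) = w (m + k)) \<and> w (i - 1 - j) \<noteq> w (m + j) \<and>
      (Q i < R m) = w (m + j)"
    if "L \<le> i" "(1 / 4) ^ L < \<bar>Q i - R m\<bar>" for L i m
    using that
  proof (induction L arbitrary: i m)
    case 0
    then show ?case using R01[of m] Q01[of i] by auto
  next
    case (Suc L)
    then obtain i' where i: "i = Suc i'" by (cases i) auto
    show ?case
    proof (cases "w i' = w m")
      case False
      then have "(Q i < R m) = w m"
        using f_less[OF R01[of "Suc m"] Q01[of i']] f_less[OF Q01[of i'] R01[of "Suc m"]]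
        unfolding i Q R[of m] by (cases "w m") auto
      then show ?thesis
        using False i by (intro exI[of _ 0]) auto
    next
      case True
      have "(1 / 4) ^ L < \<bar>Q i' - R (Suc m)\<bar>"
        using Suc.prems(2) f_contr[OF Q01(1)[of i'] R01(1)[of "Suc m"], of "w m"]
        unfolding i Q R[of m] True by simp
      then obtain j where j: "j < L" "\<And>k. k < j \<Longrightarrow> w (i' - 1 - k) = w (Suc m + k)"
        "w (i' - 1 - j) \<noteq> w (Suc m + j)" "(Q i' < R (Suc m)) = w (Suc m + j)"
        using Suc.IH[of i' "Suc m"] Suc.prems(1) i by auto
      have "w (i - 1 - k) = w (m + k)" if "k < Suc j" for k
        using j(2)[of "k - 1"] that True i by (cases k) auto
      moreover have "(Q i < R m) = (Q i' < R (Suc m))"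
        unfolding i Q R[of m] True using f_mono Q01 R01 by auto
      ultimately show ?thesis
        using j i by (intro exI[of _ "Suc j"]) auto
    qed
  qed
  obtain L where L: "(1 / 4) ^ L < 4 * \<delta>"
    using \<delta> real_arch_pow_inv[of "4 * \<delta>" "1 / 4"] by auto
  have "markov_at L w i" if i: "Suc L \<le> i" "w i \<noteq> w (i + 1)" for i
  proof -
    have gap: "if w i then Q i + 4 * \<delta> \<le> R (i + 2) else R (i + 2) + 4 * \<delta> \<le> Q i"
      using w1[of i] w2[of i] w1[of "i + 1"] w2[of "i + 1"] i
        gap_at_1_2[of "n + 1 + 2 * i"] gap_at_2_1[of "n + 1 + 2 * i"]
      by (auto simp: Q_def R_def algebra_simps numeral_eq_Suc)
    then have "(1 / 4) ^ L < \<bar>Q i - R (i + 2)\<bar>"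
      using L by (auto split: if_splits)
    with compare[of L i "i + 2"] i(1) obtain j where j: "j < L" "\<forall>k<j. w (i - 1 - k) = w (i + 2 + k)"
      "w (i - 1 - j) \<noteq> w (i + 2 + j)" "(Q i < R (i + 2)) = w (i + 2 + j)"
      by auto
    have "w (i + 2 + j) = w i"
      using gap \<delta> j(4) by (auto split: if_splits)
    then show ?thesis
      unfolding markov_at_def using j i(2) by (intro exI[of _ j]) auto
  qed
  then have "markov_word L w"
    unfolding markov_word_def by (intro exI[of _ "Suc L"]) auto
  then show ?thesis
    unfolding w_def by blast
qed

lemma eventually_const_or_markov:
  "(\<exists>N. \<forall>i\<ge>N. d i = d N) \<or> (\<exists>n L. (\<forall>i. d (n + 2 * i) = d (n + 2 * i + 1)) \<and> markov_word L (\<lambda>i. d (n + 2 * i) = 1))"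
proof (cases "\<exists>n\<ge>1. d n \<noteq> d (n + 1)")
  case True
  then show ?thesis
    using markov_word_pairs digits_paired by blast
next
  case False
  have "d i = d 1" if "1 \<le> i" for i
    using that
  proof (induction i rule: dec_induct)
    case (step n)
    then show ?case using False by (metis Suc_eq_plus1)
  qed simp
  then show ?thesis by blast
qed

end

lemma countable_markov_digits:
  "countable {d :: nat \<Rightarrow> nat. \<exists>n L. (\<forall>i\<ge>n. d i = 1 \<or> d i = 2) \<and>
     (\<forall>i. d (n + 2 * i) = d (n + 2 * i + 1)) \<and> markov_word L (\<lambda>i. d (n + 2 * i) = 1)}" (is "countable ?B")
proof (rule countable_if_determined[where K = "(UNIV :: nat list set) \<times> (\<Union>L. {w. markov_word L w})" and
      R = "\<lambda>d (u, w). (\<forall>i<length u. d i = u ! i) \<and> (\<forall>i. d (length u + 2 * i) = (if w i then 1 else 2) \<and>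
        d (length u + 2 * i + 1) = (if w i then 1 else 2))"])
  show "countable ((UNIV :: nat list set) \<times> (\<Union>L. {w. markov_word L w}))"
    using countable_markov_words by blast
next
  fix d assume "d \<in> ?B"
  then obtain n L where d: "\<forall>i\<ge>n. d i = 1 \<or> d i = 2" "\<forall>i. d (n + 2 * i) = d (n + 2 * i + 1)"
    "markov_word L (\<lambda>i. d (n + 2 * i) = 1)" by blast
  have "d (n + 2 * i) = (if d (n + 2 * i) = 1 then 1 else 2) \<and>
      d (n + 2 * i + 1) = (if d (n + 2 * i) = 1 then 1 else 2)" for i
    using d(1)[rule_format, of "n + 2 * i"] d(2)[rule_format, of i] by (metis le_add1)
  then show "\<exists>k\<in>(UNIV :: nat list set) \<times> (\<Union>L. {w. markov_word L w}).
      (\<lambda>(u, w). (\<forall>i<length u. d i = u ! i) \<and> (\<forall>i. d (length u + 2 * i) = (if w i then 1 else 2) \<and>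
        d (length u + 2 * i + 1) = (if w i then 1 else 2))) k"
    using d(3) by (intro bexI[of _ "(map d [0..<n], \<lambda>i. d (n + 2 * i) = 1)"]) (simp_all, blast)
next
  fix a b :: "nat \<Rightarrow> nat" and k
  assume "(\<lambda>(u, w). (\<forall>i<length u. a i = u ! i) \<and> (\<forall>i. a (length u + 2 * i) = (if w i then 1 else 2) \<and>
        a (length u + 2 * i + 1) = (if w i then 1 else 2))) k"
    "(\<lambda>(u, w). (\<forall>i<length u. b i = u ! i) \<and> (\<forall>i. b (length u + 2 * i) = (if w i then 1 else 2) \<and>
        b (length u + 2 * i + 1) = (if w i then 1 else 2))) k"
  moreover obtain u w where "k = (u, w)" by fastforce
  ultimately have *: "\<And>i. i < length u \<Longrightarrow> a i = b i" "\<And>i. a (length u + 2 * i) = b (length u + 2 * i)"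
      "\<And>i. a (length u + 2 * i + 1) = b (length u + 2 * i + 1)"
    by simp_all
  show "a = b"
  proof
    fix i
    consider "i < length u" | j where "i = length u + 2 * j" | j where "i = length u + 2 * j + 1"
    proof (cases "i < length u")
      case False
      then obtain e where "i = length u + e" by (metis le_Suc_ex not_le)
      then show ?thesis
        using that(2,3) by (cases "even e") (auto elim!: evenE oddE)
    qed
    then show "a i = b i"
      using * by cases simp_all
  qed
qed

section \<open>The Gauss map, convergents and the approximation constant\<close>

fun gauss_orbit :: "real \<Rightarrow> nat \<Rightarrow> real" where
  "gauss_orbit x 0 = x"
| "gauss_orbit x (Suc n) = frac (1 / gauss_orbit x n)"

declare gauss_orbit.simps(2) [simp del]

definition cf_digit :: "real \<Rightarrow> nat \<Rightarrow> nat" where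
  "cf_digit x n = nat \<lfloor>1 / gauss_orbit x n\<rfloor>"

text \<open>The index is shifted by one: \<open>cf_num\<close> and \<open>cf_den\<close> at \<open>Suc n\<close> give the convergent with the
  digits below \<open>n\<close>, and at 0 the formal convergent \<open>1/0\<close>.\<close>

fun cf_num cf_den :: "(nat \<Rightarrow> nat) \<Rightarrow> nat \<Rightarrow> nat" where
  "cf_num d 0 = 1"
| "cf_num d (Suc 0) = 0"
| "cf_num d (Suc (Suc n)) = d n * cf_num d (Suc n) + cf_num d n"
| "cf_den d 0 = 0"
| "cf_den d (Suc 0) = 1"
| "cf_den d (Suc (Suc n)) = d n * cf_den d (Suc n) + cf_den d n"

context
  fixes x :: real
  assumes x: "0 < x" "x < 1" "x \<notin> \<rat>"
begin

lemma gauss_orbit_irrational: "gauss_orbit x n \<notin> \<rat>" "0 < gauss_orbit x n" "gauss_orbit x n < 1"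
proof -
  have "gauss_orbit x n \<notin> \<rat> \<and> 0 < gauss_orbit x n \<and> gauss_orbit x n < 1"
  proof (induction n)
    case (Suc n)
    let ?y = "1 / gauss_orbit x n"
    have "?y \<notin> \<rat>"
    proof
      assume "?y \<in> \<rat>"
      then have "inverse ?y \<in> \<rat>" by (rule Rats_inverse)
      then show False using Suc by simp
    qed
    then have irr: "frac ?y \<notin> \<rat>"
      by (metis Rats_add Rats_of_int add.commute diff_add_cancel frac_def)
    then have "frac ?y \<noteq> 0" by (metis Rats_0)
    then show ?case
      using irr frac_ge_0[of ?y] frac_lt_1[of ?y] by (simp add: gauss_orbit.simps(2) less_le)
  qed (use x in auto)
  then show "gauss_orbit x n \<notin> \<rat>" "0 < gauss_orbit x n" "gauss_orbit x n < 1" by auto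
qed

lemma inverse_gauss_orbit: "1 / gauss_orbit x n = cf_digit x n + gauss_orbit x (n + 1)"
  using gauss_orbit_irrational(2,3)[of n] by (simp add: cf_digit_def gauss_orbit.simps(2) frac_def)

lemma gauss_orbit_step: "gauss_orbit x n = 1 / (cf_digit x n + gauss_orbit x (n + 1))"
  using inverse_gauss_orbit[of n] by (metis div_by_1 divide_divide_eq_right mult_1)

lemma cf_digit_pos: "1 \<le> cf_digit x n"
proof -
  have "1 < 1 / gauss_orbit x n"
    using gauss_orbit_irrational(2,3)[of n] by (simp add: field_simps)
  then have "1 \<le> \<lfloor>1 / gauss_orbit x n\<rfloor>" by linarith
  then show ?thesis unfolding cf_digit_def by linarith
qed

lemma cf_den_ge: "1 \<le> cf_den (cf_digit x) (Suc n)" "n \<le> cf_den (cf_digit x) (Suc n)"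
proof -
  have "1 \<le> cf_den (cf_digit x) (Suc n) \<and> n \<le> cf_den (cf_digit x) (Suc n)"
  proof (induction n rule: less_induct)
    case (less n)
    show ?case
    proof (cases n)
      case (Suc m)
      have "cf_den (cf_digit x) (Suc m) \<le> cf_digit x m * cf_den (cf_digit x) (Suc m)"
        using cf_digit_pos[of m] by simp
      then have "cf_den (cf_digit x) (Suc m) + cf_den (cf_digit x) m \<le> cf_den (cf_digit x) (Suc (Suc m))"
        unfolding cf_den.simps by (rule add_right_mono)
      moreover have "m = 0 \<or> 1 \<le> cf_den (cf_digit x) m"
        using less.IH[of "m - 1"] Suc by (cases m) auto
      ultimately show ?thesis
        using less.IH[of m] unfolding Suc by (cases m) (simp, linarith)
    qed simp
  qed
  then show "1 \<le> cf_den (cf_digit x) (Suc n)" "n \<le> cf_den (cf_digit x) (Suc n)" by auto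
qed

definition cf_err :: "nat \<Rightarrow> real" where
  "cf_err n = cf_den (cf_digit x) n * x - cf_num (cf_digit x) n"

lemma cf_err_Suc: "cf_err (Suc n) = - gauss_orbit x n * cf_err n"
proof (induction n)
  case 0
  then show ?case by (simp add: cf_err_def)
next
  case (Suc n)
  have "cf_err (Suc (Suc n)) = cf_digit x n * cf_err (Suc n) + cf_err n"
    by (simp add: cf_err_def algebra_simps)
  moreover have "cf_err n = - (1 / gauss_orbit x n) * cf_err (Suc n)"
    using Suc gauss_orbit_irrational(2)[of n] by simp
  ultimately show ?case
    unfolding inverse_gauss_orbit by (simp add: algebra_simps)
qed

text \<open>This is |p q' - p' q| = 1 for neighbouring convergents, written with the errors q x - p:
  the terms containing \<open>x\<close> cancel.\<close>

lemma cf_determinant: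
  "\<bar>cf_den (cf_digit x) (Suc n) * cf_err n - cf_den (cf_digit x) n * cf_err (Suc n)\<bar> = 1"
proof (induction n)
  case 0
  then show ?case by (simp add: cf_err_def)
next
  case (Suc n)
  have e: "cf_err (Suc (Suc n)) = cf_digit x n * cf_err (Suc n) + cf_err n"
    by (simp add: cf_err_def algebra_simps)
  show ?case
    using Suc unfolding e by (simp add: algebra_simps abs_minus_commute)
qed

text \<open>The classical formula 1 / (q |q x - p|) = [d n; d (n+1), ...] + [0; d (n-1), ..., d 0].
  It is the determinant identity, once \<open>cf_err_Suc\<close> expresses one error by its
  neighbour.\<close>

lemma approximation_constant:
  "cf_den (cf_digit x) (Suc n) * \<bar>cf_err (Suc n)\<bar> *
    (1 / gauss_orbit x n + cf_den (cf_digit x) n / cf_den (cf_digit x) (Suc n)) = 1"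
proof -
  let ?q = "real (cf_den (cf_digit x) (Suc n))" and ?q' = "real (cf_den (cf_digit x) n)" and ?g = "gauss_orbit x n"
  have g: "0 < ?g" by (rule gauss_orbit_irrational)
  have q: "0 < ?q" using cf_den_ge(1)[of n] by linarith
  have "?q * cf_err n - ?q' * cf_err (Suc n) = cf_err n * (?q + ?g * ?q')"
    unfolding cf_err_Suc by (simp add: algebra_simps)
  then have "\<bar>cf_err n\<bar> * (?q + ?g * ?q') = 1"
    using cf_determinant[of n] g q by (simp add: abs_mult)
  moreover have "\<bar>cf_err (Suc n)\<bar> = ?g * \<bar>cf_err n\<bar>"
    unfolding cf_err_Suc using g by (simp add: abs_mult)
  moreover have "?q * (?g * \<bar>cf_err n\<bar>) * (1 / ?g + ?q' / ?q) = \<bar>cf_err n\<bar> * (?q + ?g * ?q')"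
    using g q by (simp add: field_simps)
  ultimately show ?thesis by simp
qed

end

text \<open>With equal digits the inverses of the orbit points differ exactly as the next orbit
  points do, which gives the factor x_n y_n. Two consecutive points of one orbit have product at
  most 1/2, so two steps contract by 4.\<close>

lemma cf_digit_inj:
  assumes "0 < x" "x < 1" "x \<notin> \<rat>" "0 < y" "y < 1" "y \<notin> \<rat>" "cf_digit x = cf_digit y"
  shows "x = y"
proof -
  have step: "\<bar>gauss_orbit x n - gauss_orbit y n\<bar> \<le> 1 / 4 * \<bar>gauss_orbit x (n + 2) - gauss_orbit y (n + 2)\<bar>" for n
  proof -
    let ?x = "\<lambda>n. gauss_orbit x n" and ?y = "\<lambda>n. gauss_orbit y n"
    have pos: "0 < ?x n" "0 < ?y n" "?x n < 1" "?y n < 1" for n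
      using gauss_orbit_irrational assms by auto
    have diff: "\<bar>?x n - ?y n\<bar> = ?x n * ?y n * \<bar>?x (n + 1) - ?y (n + 1)\<bar>" for n
    proof -
      have "1 / ?x n - 1 / ?y n = ?x (n + 1) - ?y (n + 1)"
        using inverse_gauss_orbit[of x n] inverse_gauss_orbit[of y n] assms by simp
      then have "?y n - ?x n = ?x n * ?y n * (?x (n + 1) - ?y (n + 1))"
        using pos[of n] by (simp add: field_simps)
      then show ?thesis
        using pos[of n] by (metis abs_minus_commute abs_mult abs_of_pos)
    qed
    have half: "gauss_orbit z n * gauss_orbit z (n + 1) \<le> 1 / 2" if z: "0 < z" "z < 1" "z \<notin> \<rat>" for z
    proof -
      let ?t = "gauss_orbit z (n + 1)"
      have t: "0 < ?t" "?t < 1" using gauss_orbit_irrational[OF z] by auto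
      have "gauss_orbit z n \<le> 1 / (1 + ?t)"
        unfolding gauss_orbit_step[OF z, of n] using t cf_digit_pos[OF z, of n]
        by (intro divide_left_mono) auto
      then have "gauss_orbit z n * ?t \<le> 1 / (1 + ?t) * ?t"
        using t by (intro mult_right_mono) auto
      also have "\<dots> \<le> 1 / 2"
        using t by (simp add: field_simps)
      finally show ?thesis .
    qed
    have "(?x n * ?x (n + 1)) * (?y n * ?y (n + 1)) \<le> 1 / 2 * (1 / 2)"
      using pos half assms by (intro mult_mono) (auto intro: mult_nonneg_nonneg less_imp_le)
    then have "(?x n * ?x (n + 1)) * (?y n * ?y (n + 1)) * \<bar>?x (n + 2) - ?y (n + 2)\<bar> \<le> 1 / 4 * \<bar>?x (n + 2) - ?y (n + 2)\<bar>"
      by (intro mult_right_mono) auto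
    then show ?thesis
      using diff[of n] diff[of "n + 1"] by (simp add: algebra_simps)
  qed
  have "\<bar>gauss_orbit x n - gauss_orbit y n\<bar> \<le> (1 / 4) ^ k" for k n
  proof (induction k arbitrary: n)
    case 0
    show ?case
      using gauss_orbit_irrational(2,3)[of x n] gauss_orbit_irrational(2,3)[of y n] assms by auto
  next
    case (Suc k)
    show ?case
      using step[of n] Suc[of "n + 2"] by simp
  qed
  then have *: "\<bar>x - y\<bar> \<le> (1 / 4) ^ k" for k
    by (metis gauss_orbit.simps(1))
  show ?thesis
  proof (rule ccontr)
    assume "x \<noteq> y"
    then obtain k where "(1 / 4) ^ k < \<bar>x - y\<bar>"
      using real_arch_pow_inv[of "\<bar>x - y\<bar>" "1 / 4"] by auto
    then show False using *[of k] by simp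
  qed
qed

text \<open>Shifting by \<open>Q\<close> suffices because the denominator with index
  \<open>n + 1\<close> is at least \<open>n\<close>: from there on the gap applies to every
  convergent.\<close>

lemma markov_digits_of_gap:
  assumes x: "0 < x" "x < 1" "x \<notin> \<rat>" and c: "1 / 3 < c"
    and gap: "\<And>q p. Q \<le> q \<Longrightarrow> 1 \<le> q \<Longrightarrow> c / (real q)\<^sup>2 \<le> \<bar>x - of_int p / real q\<bar>"
  shows "markov_digits (\<lambda>n. cf_digit x (n + Q)) (\<lambda>n. gauss_orbit x (n + Q))
    (\<lambda>n. cf_den (cf_digit x) (n + Q) / cf_den (cf_digit x) (n + Q + 1)) (3 - 1 / c)"
proof -
  note irr = gauss_orbit_irrational[OF x]
  have den: "0 < cf_den (cf_digit x) (Suc n)" for n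
    using cf_den_ge(1)[OF x, of n] by simp
  have den_mono: "cf_den (cf_digit x) n \<le> cf_den (cf_digit x) (Suc n)" for n
  proof (cases n)
    case (Suc m)
    have "cf_den (cf_digit x) (Suc m) \<le> cf_digit x m * cf_den (cf_digit x) (Suc m)"
      using cf_digit_pos[OF x, of m] by simp
    then show ?thesis
      unfolding Suc cf_den.simps by (rule trans_le_add1)
  qed simp
  have main: "cf_digit x n + gauss_orbit x (n + 1) + cf_den (cf_digit x) n / cf_den (cf_digit x) (n + 1) \<le> 1 / c"
    if "Q \<le> n" for n
  proof -
    let ?q = "cf_den (cf_digit x) (Suc n)"
    let ?s = "1 / gauss_orbit x n + cf_den (cf_digit x) n / ?q"
    have s: "0 < ?s" using irr(2)[of n] by (simp add: add_pos_nonneg)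
    have "c / (real ?q)\<^sup>2 \<le> \<bar>x - of_int (int (cf_num (cf_digit x) (Suc n))) / real ?q\<bar>"
      using gap[of ?q "int (cf_num (cf_digit x) (Suc n))"] cf_den_ge(1,2)[OF x, of n] that by linarith
    also have "x - of_int (int (cf_num (cf_digit x) (Suc n))) / real ?q = cf_err x (Suc n) / ?q"
      using den[of n] by (simp add: cf_err_def[OF x] field_simps)
    also have "\<bar>cf_err x (Suc n) / ?q\<bar> = (?q * \<bar>cf_err x (Suc n)\<bar>) / (real ?q)\<^sup>2"
      using den[of n] by (simp add: power2_eq_square abs_divide)
    finally have "c \<le> ?q * \<bar>cf_err x (Suc n)\<bar>"
      using den[of n] by (simp add: divide_le_cancel)
    then have "c * ?s \<le> 1"
      using approximation_constant[OF x, of n] s by (metis less_imp_le mult_right_mono)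
    then have "?s \<le> 1 / c"
      using c by (simp add: field_simps)
    then show ?thesis
      unfolding inverse_gauss_orbit[OF x, of n] by simp
  qed
  have c3: "1 / c < 3" using c by (simp add: field_simps)
  show ?thesis
  proof
    fix n
    show "cf_digit x (n + Q) = 1 \<or> cf_digit x (n + Q) = 2"
    proof -
      have "0 \<le> real (cf_den (cf_digit x) (n + Q)) / real (cf_den (cf_digit x) (n + Q + 1))" by simp
      then have "real (cf_digit x (n + Q)) < 3"
        using main[OF le_add2, of n] c3 irr(2)[of "n + Q + 1"] by linarith
      then show ?thesis using cf_digit_pos[OF x, of "n + Q"] by linarith
    qed
    show "0 < gauss_orbit x (n + Q)" "gauss_orbit x (n + Q) < 1" using irr by auto
    show "gauss_orbit x (n + Q) = 1 / (real (cf_digit x (n + Q)) + gauss_orbit x (n + 1 + Q))"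
      using gauss_orbit_step[OF x, of "n + Q"] by (simp add: algebra_simps)
    show "0 \<le> real (cf_den (cf_digit x) (n + Q)) / real (cf_den (cf_digit x) (n + Q + 1))" by simp
    show "real (cf_den (cf_digit x) (n + Q)) / real (cf_den (cf_digit x) (n + Q + 1)) \<le> 1"
      using den_mono[of "n + Q"] den[of "n + Q"] by simp
    show "real (cf_den (cf_digit x) (n + 1 + Q)) / real (cf_den (cf_digit x) (n + 1 + Q + 1)) =
        1 / (real (cf_digit x (n + Q)) + real (cf_den (cf_digit x) (n + Q)) / real (cf_den (cf_digit x) (n + Q + 1)))"
      using den[of "n + Q"] by (simp add: field_simps)
    show "real (cf_digit x (n + Q)) + gauss_orbit x (n + 1 + Q) +
        real (cf_den (cf_digit x) (n + Q)) / real (cf_den (cf_digit x) (n + Q + 1)) \<le> 3 - (3 - 1 / c)"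
      using main[of "n + Q"] by (simp add: algebra_simps)
  qed (use c3 in auto)
qed

theorem countable_large_approximation_constant:
  assumes "1 / 3 < c"
  shows "countable {x. 0 < x \<and> x < 1 \<and> x \<notin> \<rat> \<and>
    (\<exists>Q. \<forall>q\<ge>Q. 1 \<le> q \<longrightarrow> (\<forall>p. c / (real q)\<^sup>2 \<le> \<bar>x - of_int p / real q\<bar>))}" (is "countable ?S")
proof -
  let ?A = "{d :: nat \<Rightarrow> nat. \<exists>N. \<forall>i\<ge>N. d i = d N}"
  let ?B = "{d :: nat \<Rightarrow> nat. \<exists>n L. (\<forall>i\<ge>n. d i = 1 \<or> d i = 2) \<and>
     (\<forall>i. d (n + 2 * i) = d (n + 2 * i + 1)) \<and> markov_word L (\<lambda>i. d (n + 2 * i) = 1)}"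
  have "cf_digit x \<in> ?A \<union> ?B" if "x \<in> ?S" for x
  proof -
    from that obtain Q where x: "0 < x" "x < 1" "x \<notin> \<rat>"
      and Q: "\<And>q p. Q \<le> q \<Longrightarrow> 1 \<le> q \<Longrightarrow> c / (real q)\<^sup>2 \<le> \<bar>x - of_int p / real q\<bar>" by blast
    interpret markov_digits "\<lambda>n. cf_digit x (n + Q)" "\<lambda>n. gauss_orbit x (n + Q)"
      "\<lambda>n. cf_den (cf_digit x) (n + Q) / cf_den (cf_digit x) (n + Q + 1)" "3 - 1 / c"
      by (rule markov_digits_of_gap[OF x assms Q])
    from eventually_const_or_markov show ?thesis
    proof
      assume "\<exists>N. \<forall>i\<ge>N. cf_digit x (i + Q) = cf_digit x (N + Q)"
      then obtain N where N: "\<And>i. N \<le> i \<Longrightarrow> cf_digit x (i + Q) = cf_digit x (N + Q)" by blast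
      have "cf_digit x i = cf_digit x (N + Q)" if "N + Q \<le> i" for i
        using N[of "i - Q"] that by simp
      then show ?thesis by blast
    next
      assume "\<exists>n L. (\<forall>i. cf_digit x (n + 2 * i + Q) = cf_digit x (n + 2 * i + 1 + Q)) \<and>
        markov_word L (\<lambda>i. cf_digit x (n + 2 * i + Q) = 1)"
      then obtain n L where n: "\<And>i. cf_digit x (n + 2 * i + Q) = cf_digit x (n + 2 * i + 1 + Q)"
        "markov_word L (\<lambda>i. cf_digit x (n + 2 * i + Q) = 1)" by blast
      have "cf_digit x i = 1 \<or> cf_digit x i = 2" if "n + Q \<le> i" for i
        using digit[of "i - Q"] that by simp
      moreover have "cf_digit x (n + Q + 2 * i) = cf_digit x (n + Q + 2 * i + 1)" for i
        using n(1)[of i] by (simp add: ac_simps)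
      moreover have "markov_word L (\<lambda>i. cf_digit x (n + Q + 2 * i) = 1)"
        using n(2) by (simp add: ac_simps)
      ultimately have "cf_digit x \<in> ?B"
        by blast
      then show ?thesis by blast
    qed
  qed
  then have "cf_digit ` ?S \<subseteq> ?A \<union> ?B" by blast
  moreover have "countable (?A \<union> ?B)"
    using countable_eventually_const countable_markov_digits by (rule countable_Un)
  ultimately have "countable (cf_digit ` ?S)"
    by (rule countable_subset)
  moreover have "inj_on cf_digit ?S"
    by (rule inj_onI) (use cf_digit_inj in blast)
  ultimately show ?thesis
    by (rule countable_image_inj_on)
qed

section \<open>Hausdorff, packing and box dimension\<close>

text \<open>Pairwise distances take the place of \<open>diameter\<close>, whose default 0 on
  unbounded sets would let such sets through.\<close>

definition coverable :: "real \<Rightarrow> nat \<Rightarrow> 'a::metric_space set \<Rightarrow> bool" where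
  "coverable \<delta> n A \<longleftrightarrow> (\<exists>F. finite F \<and> card F \<le> n \<and> A \<subseteq> \<Union>F \<and>
     (\<forall>U\<in>F. \<forall>x\<in>U. \<forall>y\<in>U. dist x y \<le> \<delta>))"

text \<open>Upper box dimension at most \<open>t\<close>, in the sharper form of a bound without
  loss in the exponent, which multiplies directly over products.\<close>

definition box_bounded :: "real \<Rightarrow> 'a::metric_space set \<Rightarrow> bool" where
  "box_bounded t A \<longleftrightarrow> (\<exists>C\<ge>0. \<forall>\<delta>. 0 < \<delta> \<and> \<delta> \<le> 1 \<longrightarrow>
     (\<exists>n. coverable \<delta> n A \<and> real n \<le> C * \<delta> powr (- t)))"

lemma hausdorff_pre_mono: "A \<subseteq> B \<Longrightarrow> hausdorff_pre s \<delta> A \<le> hausdorff_pre s \<delta> B"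
  unfolding hausdorff_pre_def by (rule INF_superset_mono) auto

lemma hausdorff_pre_antimono: "\<delta> \<le> \<epsilon> \<Longrightarrow> hausdorff_pre s \<epsilon> A \<le> hausdorff_pre s \<delta> A"
  unfolding hausdorff_pre_def by (rule INF_superset_mono) (auto intro: order_trans)

lemma hausdorff_measure_eq_0_iff: "hausdorff_measure s A = 0 \<longleftrightarrow> (\<forall>\<delta>>0. hausdorff_pre s \<delta> A = 0)"
  unfolding hausdorff_measure_def using SUP_bot_conv(1)[of "\<lambda>\<delta>. hausdorff_pre s \<delta> A" "{0<..}"]
  by (auto simp: bot_ennreal)

lemma suminf_half_ennreal: "0 \<le> e \<Longrightarrow> (\<Sum>i. ennreal (e * (1 / 2) ^ Suc i)) = ennreal e"
  using sums_mult[OF power_half_series, of e]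
  by (subst suminf_ennreal2) (auto simp: sums_iff)

lemma hausdorff_pre_UN_le:
  fixes A :: "nat \<Rightarrow> 'a::metric_space set"
  shows "hausdorff_pre s \<delta> (\<Union>i. A i) \<le> (\<Sum>i. hausdorff_pre s \<delta> (A i))"
proof (rule ennreal_le_epsilon)
  fix e :: real assume e: "0 < e" and fin: "(\<Sum>i. hausdorff_pre s \<delta> (A i)) < top"
  have "\<exists>U. A i \<subseteq> (\<Union>j. U j) \<and> (\<forall>j. bounded (U j) \<and> diameter (U j) \<le> \<delta>) \<and>
      (\<Sum>j. ennreal (diameter (U j) powr s)) \<le> hausdorff_pre s \<delta> (A i) + ennreal (e * (1 / 2) ^ Suc i)" for i
  proof -
    have "hausdorff_pre s \<delta> (A i) \<le> (\<Sum>i. hausdorff_pre s \<delta> (A i))"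
      using sum_le_suminf[of "\<lambda>i. hausdorff_pre s \<delta> (A i)" "{i}"] by simp
    then have "hausdorff_pre s \<delta> (A i) < top"
      using fin by (rule le_less_trans)
    then have "hausdorff_pre s \<delta> (A i) < hausdorff_pre s \<delta> (A i) + ennreal (e * (1 / 2) ^ Suc i)"
      using e ennreal_add_left_cancel_less[of "hausdorff_pre s \<delta> (A i)" 0 "ennreal (e * (1 / 2) ^ Suc i)"]
      by (simp add: less_top)
    then show ?thesis
      unfolding hausdorff_pre_def INF_less_iff by (auto intro: less_imp_le)
  qed
  then obtain U where U: "\<And>i. A i \<subseteq> (\<Union>j. U i j)" "\<And>i j. bounded (U i j) \<and> diameter (U i j) \<le> \<delta>"
    "\<And>i. (\<Sum>j. ennreal (diameter (U i j) powr s)) \<le> hausdorff_pre s \<delta> (A i) + ennreal (e * (1 / 2) ^ Suc i)"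
    by metis
  define V where "V n = (case prod_decode n of (i, j) \<Rightarrow> U i j)" for n
  have "(\<Union>i. A i) \<subseteq> (\<Union>n. V n)"
  proof
    fix x assume "x \<in> (\<Union>i. A i)"
    then obtain i j where "x \<in> U i j" using U(1) by blast
    then have "x \<in> V (prod_encode (i, j))" by (simp add: V_def)
    then show "x \<in> (\<Union>n. V n)" by blast
  qed
  then have "hausdorff_pre s \<delta> (\<Union>i. A i) \<le> (\<Sum>n. ennreal (diameter (V n) powr s))"
    unfolding hausdorff_pre_def using U(2)
    by (intro INF_lower) (auto simp: V_def split: prod.splits)
  also have "\<dots> = (\<Sum>n. (\<lambda>(i, j). ennreal (diameter (U i j) powr s)) (prod_decode n))"
    by (simp add: V_def case_prod_beta)
  also have "\<dots> = (\<Sum>i. \<Sum>j. ennreal (diameter (U i j) powr s))"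
    by (rule suminf_ennreal_2dimen) auto
  also have "\<dots> \<le> (\<Sum>i. hausdorff_pre s \<delta> (A i) + ennreal (e * (1 / 2) ^ Suc i))"
    by (intro suminf_le U(3)) auto
  also have "\<dots> = (\<Sum>i. hausdorff_pre s \<delta> (A i)) + (\<Sum>i. ennreal (e * (1 / 2) ^ Suc i))"
    by (rule suminf_add[symmetric]) auto
  also have "(\<Sum>i. ennreal (e * (1 / 2) ^ Suc i)) = ennreal e"
    using e by (intro suminf_half_ennreal) simp
  finally show "hausdorff_pre s \<delta> (\<Union>i. A i) \<le> (\<Sum>i. hausdorff_pre s \<delta> (A i)) + ennreal e" .
qed

lemma hausdorff_measure_UN_null:
  fixes A :: "nat \<Rightarrow> 'a::metric_space set"
  assumes "\<And>i. hausdorff_measure s (A i) = 0" "B \<subseteq> (\<Union>i. A i)"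
  shows "hausdorff_measure s B = 0"
  unfolding hausdorff_measure_eq_0_iff
proof (intro allI impI)
  fix \<delta> :: real assume "0 < \<delta>"
  then have "hausdorff_pre s \<delta> (A i) = 0" for i
    using assms(1) hausdorff_measure_eq_0_iff by blast
  then have "hausdorff_pre s \<delta> (\<Union>i. A i) \<le> 0"
    using hausdorff_pre_UN_le[of s \<delta> A] by simp
  then show "hausdorff_pre s \<delta> B = 0"
    using hausdorff_pre_mono[OF assms(2), of s \<delta>] by simp
qed

lemma hausdorff_pre_le_coverable:
  fixes A :: "'a::metric_space set"
  assumes "coverable \<delta> n A" "0 \<le> \<delta>" "\<delta> \<le> \<epsilon>" "0 \<le> s"
  shows "hausdorff_pre s \<epsilon> A \<le> ennreal (real n * \<delta> powr s)"
proof -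
  from assms(1) obtain F where F: "finite F" "card F \<le> n" "A \<subseteq> \<Union>F"
    "\<And>U x y. U \<in> F \<Longrightarrow> x \<in> U \<Longrightarrow> y \<in> U \<Longrightarrow> dist x y \<le> \<delta>"
    unfolding coverable_def by blast
  obtain h where h: "bij_betw h {..<card F} F"
    using ex_bij_betw_nat_finite[OF F(1)] by (auto simp: atLeast0LessThan)
  \<comment> \<open>Padding with empty sets is free: their diameter is 0, and
    \<open>0 powr s\<close> is 0.\<close>
  define U where "U i = (if i < card F then h i else {})" for i
  have diam: "diameter V \<le> \<delta>" if "V \<in> F" for V
    unfolding diameter_def using that assms(2) F(4) by (auto intro!: cSUP_least)
  have bdd: "bounded V" if "V \<in> F" for V
  proof (cases "V = {}")
    case False
    then obtain x where "x \<in> V" by auto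
    then show ?thesis
      unfolding bounded_def using F(4)[OF that] by blast
  qed simp
  have UF: "U i \<in> F" if "i < card F" for i
    using h that by (auto simp: U_def bij_betw_def)
  have U: "bounded (U i) \<and> diameter (U i) \<le> \<epsilon>" for i
    using UF[of i] bdd diam assms(2,3) by (cases "i < card F") (auto simp: U_def intro: order_trans)
  have "A \<subseteq> (\<Union>i. U i)"
  proof
    fix x assume "x \<in> A"
    then obtain V where V: "V \<in> F" "x \<in> V" using F(3) by blast
    then obtain i where "i < card F" "h i = V"
      using h by (metis bij_betw_def imageE lessThan_iff)
    then show "x \<in> (\<Union>i. U i)" using V by (auto simp: U_def intro!: exI[of _ i])
  qed
  then have "hausdorff_pre s \<epsilon> A \<le> (\<Sum>i. ennreal (diameter (U i) powr s))"
    unfolding hausdorff_pre_def using U by (intro INF_lower) auto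
  also have "\<dots> = (\<Sum>i<card F. ennreal (diameter (U i) powr s))"
    by (rule suminf_finite) (auto simp: U_def)
  also have "\<dots> \<le> (\<Sum>i<card F. ennreal (\<delta> powr s))"
    using UF diam bdd assms(4) by (intro sum_mono ennreal_leI powr_mono2 diameter_ge_0) auto
  also have "\<dots> = ennreal (real (card F) * \<delta> powr s)"
    by (simp add: ennreal_mult ennreal_of_nat_eq_real_of_nat)
  also have "\<dots> \<le> ennreal (real n * \<delta> powr s)"
    using F(2) by (intro ennreal_leI mult_right_mono) auto
  finally show ?thesis .
qed

text \<open>The doubled balls of a maximal packing by balls of radius \<open>\<rho>\<close> cover the set.\<close>

lemma hausdorff_pre_le_packing_pre:
  fixes A :: "'a::metric_space set"
  assumes "0 < \<rho>" "0 < s"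
  shows "ennreal (2 powr (- s)) * hausdorff_pre s (4 * \<rho>) A \<le> packing_pre s \<rho> A"
proof (cases "packing_pre s \<rho> A = top")
  case False
  define P where "P X \<longleftrightarrow> finite X \<and> X \<subseteq> A \<and> (\<forall>x\<in>X. \<forall>y\<in>X. x \<noteq> y \<longrightarrow> cball x \<rho> \<inter> cball y \<rho> = {})"
    for X
  have le: "ennreal (real (card X) * (2 * \<rho>) powr s) \<le> packing_pre s \<rho> A" if "P X" for X
  proof -
    have C: "(\<lambda>x. (x, \<rho>)) ` X \<in> packings \<rho> A"
      using that assms(1) by (auto simp: packings_def P_def disjoint_family_on_def intro!: countable_finite)
    have "ennreal (real (card X) * (2 * \<rho>) powr s) = (\<Sum>(x, r)\<in>(\<lambda>x. (x, \<rho>)) ` X. ennreal ((2 * r) powr s))"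
      by (subst sum.reindex) (auto simp: inj_on_def ennreal_mult ennreal_of_nat_eq_real_of_nat)
    also have "\<dots> = (\<Sum>\<^sub>\<infinity>(x, r)\<in>(\<lambda>x. (x, \<rho>)) ` X. ennreal ((2 * r) powr s))"
      using that by (subst infsum_finite) (auto simp: P_def)
    also have "\<dots> \<le> packing_pre s \<rho> A"
      unfolding packing_pre_def by (rule SUP_upper[OF C])
    finally show ?thesis .
  qed
  obtain p where p: "packing_pre s \<rho> A = ennreal p" "0 \<le> p"
    using False by (cases "packing_pre s \<rho> A") auto
  \<comment> \<open>Each ball contributes \<open>(2 * \<rho>) powr s\<close> to a finite supremum;
    the resulting bound on the number of balls lets a largest packing exist.\<close>
  have "card X \<le> nat \<lceil>p / (2 * \<rho>) powr s\<rceil>" if "P X" for X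
  proof -
    have "real (card X) * (2 * \<rho>) powr s \<le> p"
      using le[OF that] p assms by (simp add: ennreal_le_iff)
    then have "real (card X) \<le> p / (2 * \<rho>) powr s"
      using assms by (simp add: field_simps)
    then show ?thesis by linarith
  qed
  then have "\<forall>X. P X \<longrightarrow> card X < nat \<lceil>p / (2 * \<rho>) powr s\<rceil> + 1"
    by (auto simp: less_Suc_eq_le)
  moreover have "P {}" by (simp add: P_def)
  ultimately obtain X where X: "P X" "\<And>Y. P Y \<Longrightarrow> card Y \<le> card X"
    using Lattices_Big.ex_has_greatest_nat[of P "{}" card] by blast
  have "\<exists>x\<in>X. y \<in> cball x (2 * \<rho>)" if "y \<in> A" for y
  proof (rule ccontr)
    assume no: "\<not> ?thesis"
    then have ynX: "y \<notin> X" using assms by auto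
    have "cball x \<rho> \<inter> cball y \<rho> = {}" if x: "x \<in> X" for x
    proof (rule ccontr)
      assume "cball x \<rho> \<inter> cball y \<rho> \<noteq> {}"
      then obtain z where "dist x z \<le> \<rho>" "dist y z \<le> \<rho>" by auto
      then have "dist x y \<le> 2 * \<rho>"
        using dist_triangle2[of x y z] by simp
      then show False using no x by auto
    qed
    then have "P (insert y X)"
      using X(1) that by (auto simp: P_def Int_commute)
    from X(2)[OF this] show False
      using ynX X(1) by (simp add: P_def)
  qed
  then have cover: "A \<subseteq> \<Union>((\<lambda>x. cball x (2 * \<rho>)) ` X)" by blast
  have "dist y z \<le> 4 * \<rho>" if "y \<in> cball x (2 * \<rho>)" "z \<in> cball x (2 * \<rho>)" for x y z :: 'a
    using that dist_triangle3[of y z x] by auto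
  with cover have "coverable (4 * \<rho>) (card X) A"
    unfolding coverable_def using X(1)
    by (intro exI[of _ "(\<lambda>x. cball x (2 * \<rho>)) ` X"]) (auto simp: P_def card_image_le)
  then have "hausdorff_pre s (4 * \<rho>) A \<le> ennreal (real (card X) * (4 * \<rho>) powr s)"
    using assms by (intro hausdorff_pre_le_coverable) auto
  then have "ennreal (2 powr (- s)) * hausdorff_pre s (4 * \<rho>) A \<le>
      ennreal (2 powr (- s)) * ennreal (real (card X) * (4 * \<rho>) powr s)"
    by (rule mult_left_mono) simp
  also have "\<dots> = ennreal (real (card X) * (2 * \<rho>) powr s)"
  proof -
    have "(4 * \<rho>) powr s = 2 powr s * (2 * \<rho>) powr s"
      using assms by (simp flip: powr_mult)
    then have "2 powr (- s) * (real (card X) * (4 * \<rho>) powr s) = real (card X) * (2 * \<rho>) powr s"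
      by (simp add: powr_minus)
    then show ?thesis
      by (simp flip: ennreal_mult)
  qed
  finally show ?thesis
    using le[OF X(1)] by (rule order_trans)
qed simp

lemma hausdorff_pre_le_packing_premeasure:
  fixes A :: "'a::metric_space set"
  assumes "0 < \<delta>" "0 < s"
  shows "ennreal (2 powr (- s)) * hausdorff_pre s \<delta> A \<le> packing_premeasure s A"
  unfolding packing_premeasure_def
proof (rule INF_greatest)
  fix \<epsilon> :: real assume "\<epsilon> \<in> {0<..}"
  define \<rho> where "\<rho> = min \<epsilon> (\<delta> / 4)"
  have \<rho>: "0 < \<rho>" "\<rho> \<le> \<epsilon>" "4 * \<rho> \<le> \<delta>"
    using \<open>\<epsilon> \<in> {0<..}\<close> assms by (auto simp: \<rho>_def)
  have "ennreal (2 powr (- s)) * hausdorff_pre s \<delta> A \<le> ennreal (2 powr (- s)) * hausdorff_pre s (4 * \<rho>) A"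
    by (intro mult_left_mono hausdorff_pre_antimono \<rho>) simp
  also have "\<dots> \<le> packing_pre s \<rho> A"
    by (rule hausdorff_pre_le_packing_pre[OF \<rho>(1) assms(2)])
  also have "\<dots> \<le> packing_pre s \<epsilon> A"
    unfolding packing_pre_def packings_def using \<rho> by (intro SUP_subset_mono) auto
  finally show "ennreal (2 powr (- s)) * hausdorff_pre s \<delta> A \<le> packing_pre s \<epsilon> A" .
qed

lemma dimH_le_dimP:
  fixes A :: "'a::metric_space set"
  shows "dimH A \<le> dimP A"
proof -
  have "hausdorff_measure s A = 0" if s: "0 < s" "packing_measure s A = 0" for s
    unfolding hausdorff_measure_eq_0_iff
  proof (intro allI impI)
    fix \<delta> :: real assume \<delta>: "0 < \<delta>"
    let ?k = "ennreal (2 powr (- s))"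
    have "?k * hausdorff_pre s \<delta> A \<le> packing_measure s A"
      unfolding packing_measure_def
    proof (rule INF_greatest)
      fix U :: "nat \<Rightarrow> 'a set" assume "U \<in> {U. A \<subseteq> (\<Union>i. U i)}"
      then have "hausdorff_pre s \<delta> A \<le> (\<Sum>i. hausdorff_pre s \<delta> (U i))"
        using hausdorff_pre_mono hausdorff_pre_UN_le order_trans by (metis mem_Collect_eq)
      then have "?k * hausdorff_pre s \<delta> A \<le> ?k * (\<Sum>i. hausdorff_pre s \<delta> (U i))"
        by (rule mult_left_mono) simp
      also have "\<dots> = (\<Sum>i. ?k * hausdorff_pre s \<delta> (U i))"
        by simp
      also have "\<dots> \<le> (\<Sum>i. packing_premeasure s (U i))"
        by (intro suminf_le hausdorff_pre_le_packing_premeasure \<delta> s) auto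
      finally show "?k * hausdorff_pre s \<delta> A \<le> (\<Sum>i. packing_premeasure s (U i))" .
    qed
    then show "hausdorff_pre s \<delta> A = 0"
      using s by (simp add: mult_eq_0_iff)
  qed
  then show ?thesis
    unfolding dimH_def dimP_def by (intro INF_superset_mono) auto
qed

lemma dimH_nonneg: "0 \<le> dimH A"
  unfolding dimH_def by (rule INF_greatest) auto

section \<open>Packing dimension from covering numbers\<close>

lemma card_packing_le_coverable:
  fixes F :: "('a::metric_space \<times> real) set"
  assumes "coverable \<delta> n A" "finite F" "F \<subseteq> A \<times> {\<delta><..}"
    and disj: "disjoint_family_on (\<lambda>(x, r). cball x r) F" and "0 \<le> \<delta>"
  shows "card F \<le> n"
proof -
  from assms(1) obtain G where G: "finite G" "card G \<le> n" "A \<subseteq> \<Union>G"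
    "\<And>U x y. U \<in> G \<Longrightarrow> x \<in> U \<Longrightarrow> y \<in> U \<Longrightarrow> dist x y \<le> \<delta>"
    unfolding coverable_def by blast
  have "\<exists>U\<in>G. fst c \<in> U" if "c \<in> F" for c
    using that assms(3) G(3) by fastforce
  then obtain h where h: "\<And>c. c \<in> F \<Longrightarrow> h c \<in> G \<and> fst c \<in> h c" by metis
  \<comment> \<open>Two centres in one covering set are within \<delta>, so the ball around one, of
    radius above \<delta>, contains the other centre, against disjointness.\<close>
  have "inj_on h F"
  proof (rule inj_onI, rule ccontr)
    fix c c' assume c: "c \<in> F" "c' \<in> F" "h c = h c'" "c \<noteq> c'"
    obtain x r x' r' where e: "c = (x, r)" "c' = (x', r')" by fastforce
    have "dist x x' \<le> \<delta>"
      using h[OF c(1)] h[OF c(2)] c(3) G(4) e by auto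
    then have "x' \<in> cball x r" "x' \<in> cball x' r'"
      using assms(3,5) c e by auto
    moreover have "cball x r \<inter> cball x' r' = {}"
      using disj c e unfolding disjoint_family_on_def by fastforce
    ultimately show False by blast
  qed
  then have "card F \<le> card G"
    using h G(1) by (intro card_inj_on_le) auto
  then show ?thesis using G(2) by simp
qed

lemma sum_powers_ge_le:
  fixes \<rho> :: real
  assumes "0 \<le> \<rho>" "\<rho> < 1" "finite S" "S \<subseteq> {K..}"
  shows "(\<Sum>k\<in>S. \<rho> ^ k) \<le> \<rho> ^ K / (1 - \<rho>)"
proof -
  have "(\<Sum>k\<in>S. \<rho> ^ k) = (\<Sum>k\<in>S. \<rho> ^ K * \<rho> ^ (k - K))"
    using assms(4) by (intro sum.cong) (auto simp flip: power_add)
  also have "\<dots> = \<rho> ^ K * (\<Sum>j\<in>(\<lambda>k. k - K) ` S. \<rho> ^ j)"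
    using assms(4) by (subst sum.reindex[OF inj_on_diff_nat]) (auto simp: sum_distrib_left)
  also have "(\<Sum>j\<in>(\<lambda>k. k - K) ` S. \<rho> ^ j) \<le> (\<Sum>j. \<rho> ^ j)"
    using assms by (intro sum_le_suminf) auto
  also have "(\<Sum>j. \<rho> ^ j) = 1 / (1 - \<rho>)"
    using assms by (intro suminf_geometric) auto
  finally show ?thesis
    using assms by (simp add: mult_left_mono)
qed

lemma ex_dyadic:
  fixes r :: real
  assumes "0 < r" "r \<le> (1 / 2) ^ K"
  shows "\<exists>k\<ge>K. (1 / 2) ^ Suc k < r \<and> r \<le> (1 / 2) ^ k"
proof -
  have ex: "\<exists>k. (1 / 2) ^ Suc k < r"
  proof -
    obtain n where "(1 / 2) ^ n < r"
      using real_arch_pow_inv[OF assms(1), of "1 / 2"] by auto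
    moreover have "(1 / 2 :: real) ^ Suc n \<le> (1 / 2) ^ n" by simp
    ultimately show ?thesis by (meson le_less_trans)
  qed
  define k where "k = (LEAST k. (1 / 2) ^ Suc k < r)"
  have k: "(1 / 2) ^ Suc k < r"
    unfolding k_def by (rule LeastI_ex[OF ex])
  have k2: "r \<le> (1 / 2) ^ k"
  proof (cases k)
    case 0
    have "(1 / 2 :: real) ^ K \<le> 1" by (simp add: power_le_one)
    then show ?thesis using assms 0 by simp
  next
    case (Suc j)
    then show ?thesis
      using not_less_Least[of j "\<lambda>k. (1 / 2) ^ Suc k < r"] k_def by auto
  qed
  have "K \<le> k"
  proof (rule ccontr)
    assume "\<not> K \<le> k"
    then have "(1 / 2 :: real) ^ K \<le> (1 / 2) ^ Suc k"
      by (intro power_decreasing) auto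
    then show False using k assms(2) by simp
  qed
  with k k2 show ?thesis by blast
qed

text \<open>At most C 2^((k+1)t) disjoint balls have radius in (2^(-k-1), 2^(-k)], each contributing
  at most (2 2^(-k))^s. The sums over k \<ge> K are tails of a geometric series with ratio 2^(t-s) <
  1 and vanish as K grows.\<close>

lemma packing_premeasure_box_bounded:
  fixes A :: "'a::metric_space set"
  assumes "box_bounded t A" "t < s" "0 < s"
  shows "packing_premeasure s A = 0"
proof -
  from assms(1) obtain C where C: "0 \<le> C"
    "\<And>\<delta>. 0 < \<delta> \<Longrightarrow> \<delta> \<le> 1 \<Longrightarrow> \<exists>n. coverable \<delta> n A \<and> real n \<le> C * \<delta> powr (- t)"
    unfolding box_bounded_def by blast
  define \<rho> :: real where "\<rho> = 2 powr (t - s)"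
  have \<rho>: "0 < \<rho>" "\<rho> < 1"
    using assms(2) powr_less_mono[of "t - s" 0 2] by (auto simp: \<rho>_def)
  define D where "D = C * 2 powr t * 2 powr s"
  have D: "0 \<le> D" using C by (simp add: D_def)
  have half_power: "(1 / 2 :: real) ^ j = 2 powr (- real j)" for j
    by (simp add: powr_minus_divide powr_realpow power_one_over)
  have summand: "C * ((1 / 2) ^ Suc k) powr (- t) * (2 * (1 / 2) ^ k) powr s = D * \<rho> ^ k" for k :: nat
  proof -
    have "((1 / 2 :: real) ^ Suc k) powr (- t) = 2 powr ((real k + 1) * t)"
      unfolding half_power by (simp add: powr_powr algebra_simps)
    moreover have "(2 * (1 / 2 :: real) ^ k) powr s = 2 powr (s - real k * s)"
    proof -
      have "2 * (1 / 2 :: real) ^ k = 2 powr (1 - real k)"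
        unfolding half_power by (simp add: powr_diff powr_minus_divide)
      then show ?thesis by (simp add: powr_powr algebra_simps)
    qed
    moreover have "\<rho> ^ k = 2 powr ((t - s) * real k)"
      by (simp add: \<rho>_def powr_powr flip: powr_realpow)
    ultimately show ?thesis
      by (simp add: D_def algebra_simps flip: powr_add)
  qed
  have bound: "packing_pre s ((1 / 2) ^ K) A \<le> ennreal (D * (\<rho> ^ K / (1 - \<rho>)))" for K
    unfolding packing_pre_def
  proof (rule SUP_least)
    fix P assume P: "P \<in> packings ((1 / 2) ^ K) A"
    show "(\<Sum>\<^sub>\<infinity>(x, r)\<in>P. ennreal ((2 * r) powr s)) \<le> ennreal (D * (\<rho> ^ K / (1 - \<rho>)))"
    proof (subst nonneg_infsum_complete, simp, rule SUP_least)
      fix F assume "F \<in> {F. finite F \<and> F \<subseteq> P}"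
      then have F: "finite F" "F \<subseteq> A \<times> {0<..(1 / 2) ^ K}" "disjoint_family_on (\<lambda>(x, r). cball x r) F"
        using P by (auto simp: packings_def intro: disjoint_family_on_mono)
      have "\<exists>k\<ge>K. (1 / 2) ^ Suc k < snd c \<and> snd c \<le> (1 / 2) ^ k" if "c \<in> F" for c
        using that F(2) by (intro ex_dyadic) auto
      then obtain g where g: "\<And>c. c \<in> F \<Longrightarrow> K \<le> g c \<and> (1 / 2) ^ Suc (g c) < snd c \<and> snd c \<le> (1 / 2) ^ g c"
        by metis
      have group: "(\<Sum>c\<in>{c\<in>F. g c = k}. (2 * snd c) powr s) \<le> D * \<rho> ^ k" for k
      proof -
        let ?\<delta> = "(1 / 2) ^ Suc k :: real"
        have \<delta>: "0 < ?\<delta>" "?\<delta> \<le> 1" by (simp, rule power_le_one) auto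
        then obtain n where n: "coverable ?\<delta> n A" "real n \<le> C * ?\<delta> powr (- t)"
          using C(2) by blast
        have "card {c\<in>F. g c = k} \<le> n"
        proof (rule card_packing_le_coverable[OF n(1)])
          show "finite {c\<in>F. g c = k}" using F(1) by simp
          show "{c\<in>F. g c = k} \<subseteq> A \<times> {?\<delta><..}" using F(2) g by fastforce
          show "disjoint_family_on (\<lambda>(x, r). cball x r) {c\<in>F. g c = k}"
            by (rule disjoint_family_on_mono[OF _ F(3)]) auto
        qed (use \<delta> in simp)
        then have card: "real (card {c\<in>F. g c = k}) \<le> C * ?\<delta> powr (- t)"
          using n(2) by linarith
        have "(\<Sum>c\<in>{c\<in>F. g c = k}. (2 * snd c) powr s) \<le> (\<Sum>c\<in>{c\<in>F. g c = k}. (2 * (1 / 2) ^ k) powr s)"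
        proof (rule sum_mono)
          fix c assume "c \<in> {c\<in>F. g c = k}"
          then show "(2 * snd c) powr s \<le> (2 * (1 / 2) ^ k) powr s"
            using F(2) g[of c] assms by (intro powr_mono2) auto
        qed
        also have "\<dots> = real (card {c\<in>F. g c = k}) * (2 * (1 / 2) ^ k) powr s" by simp
        also have "\<dots> \<le> C * ?\<delta> powr (- t) * (2 * (1 / 2) ^ k) powr s"
          by (intro mult_right_mono card) simp
        finally show ?thesis unfolding summand .
      qed
      have "(\<Sum>c\<in>F. (2 * snd c) powr s) = (\<Sum>k\<in>g ` F. \<Sum>c\<in>{c\<in>F. g c = k}. (2 * snd c) powr s)"
        by (rule sum.image_gen[OF F(1)])
      also have "\<dots> \<le> (\<Sum>k\<in>g ` F. D * \<rho> ^ k)"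
        by (intro sum_mono group)
      also have "\<dots> = D * (\<Sum>k\<in>g ` F. \<rho> ^ k)"
        by (simp add: sum_distrib_left)
      also have "\<dots> \<le> D * (\<rho> ^ K / (1 - \<rho>))"
        using \<rho> F(1) g D by (intro mult_left_mono sum_powers_ge_le) auto
      finally show "(\<Sum>(x, r)\<in>F. ennreal ((2 * r) powr s)) \<le> ennreal (D * (\<rho> ^ K / (1 - \<rho>)))"
        by (simp add: case_prod_beta sum_ennreal ennreal_leI)
    qed
  qed
  have "packing_premeasure s A \<le> ennreal (D * (\<rho> ^ K / (1 - \<rho>)))" for K
  proof -
    have "packing_premeasure s A \<le> packing_pre s ((1 / 2) ^ K) A"
      unfolding packing_premeasure_def by (rule INF_lower) simp
    then show ?thesis using bound[of K] by (rule order_trans)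
  qed
  moreover have "(\<lambda>K. ennreal (D * (\<rho> ^ K / (1 - \<rho>)))) \<longlonglongrightarrow> ennreal (D * (0 / (1 - \<rho>)))"
    using \<rho> by (intro tendsto_ennrealI tendsto_intros LIMSEQ_realpow_zero) auto
  ultimately have "packing_premeasure s A \<le> ennreal (D * (0 / (1 - \<rho>)))"
    by (intro LIMSEQ_le_const) auto
  then show ?thesis by simp
qed

lemma dimP_le_box:
  fixes A :: "'a::metric_space set" and B :: "nat \<Rightarrow> 'a set"
  assumes "A \<subseteq> (\<Union>n. B n)" "\<And>n. box_bounded t (B n)" "0 \<le> t"
  shows "dimP A \<le> ereal t"
proof (rule ereal_le_epsilon2)
  fix e :: real assume e: "0 < e"
  have "packing_measure (t + e) A \<le> (\<Sum>n. packing_premeasure (t + e) (B n))"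
    unfolding packing_measure_def using assms(1) by (intro INF_lower) auto
  also have "\<dots> = 0"
    using packing_premeasure_box_bounded[OF assms(2)] e assms(3) by simp
  finally have "packing_measure (t + e) A = 0" by simp
  then have "dimP A \<le> ereal (t + e)"
    unfolding dimP_def using e assms(3) by (intro INF_lower) auto
  then show "dimP A \<le> ereal t + ereal e" by simp
qed

lemma box_bounded_singleton: "box_bounded 0 {x}"
proof -
  have "coverable \<delta> 1 {x}" if "0 < \<delta>" for \<delta>
    unfolding coverable_def using that by (intro exI[of _ "{{x}}"]) auto
  then show ?thesis
    unfolding box_bounded_def by (intro exI[of _ 1]) (auto intro!: exI[of _ 1])
qed

section \<open>Grids, boxes and the dimension of products\<close>

lemma coverable_grid:
  fixes A :: "real set"
  assumes "0 < h" "finite ((\<lambda>x. \<lfloor>x / h\<rfloor>) ` A)"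
  shows "coverable h (card ((\<lambda>x. \<lfloor>x / h\<rfloor>) ` A)) A"
proof -
  let ?cell = "\<lambda>j. {x. \<lfloor>x / h\<rfloor> = j}"
  have "dist x y \<le> h" if "\<lfloor>x / h\<rfloor> = \<lfloor>y / h\<rfloor>" for x y
  proof -
    have "\<bar>x / h - y / h\<bar> \<le> 1" using that by linarith
    then have "\<bar>x - y\<bar> / h \<le> 1"
      using assms(1) by (simp add: abs_divide flip: diff_divide_distrib)
    then show ?thesis
      using assms(1) by (simp add: dist_real_def field_simps)
  qed
  then show ?thesis
    unfolding coverable_def using assms(2)
    by (intro exI[of _ "?cell ` (\<lambda>x. \<lfloor>x / h\<rfloor>) ` A"]) (auto intro: card_image_le)
qed

lemma box_bounded_unit_interval: "box_bounded 1 {0..<1::real}"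
  unfolding box_bounded_def
proof (rule exI[of _ "2 :: real"], intro conjI allI impI)
  fix \<delta> :: real assume \<delta>: "0 < \<delta> \<and> \<delta> \<le> 1"
  let ?J = "(\<lambda>x. \<lfloor>x / \<delta>\<rfloor>) ` {0..<1::real}"
  have sub: "?J \<subseteq> {0..\<lfloor>1 / \<delta>\<rfloor>}"
    using \<delta> by (auto intro!: floor_mono divide_right_mono)
  then have "finite ?J" by (rule finite_subset) simp
  moreover have "real (card ?J) \<le> 2 * \<delta> powr (- 1)"
  proof -
    have "card ?J \<le> card {0..\<lfloor>1 / \<delta>\<rfloor>}"
      using sub by (intro card_mono) auto
    moreover have "0 \<le> \<lfloor>1 / \<delta>\<rfloor>"
      using \<delta> by simp
    ultimately have "real (card ?J) \<le> 1 / \<delta> + 1"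
      unfolding card_atLeastAtMost_int by linarith
    also have "\<dots> \<le> 2 * \<delta> powr (- 1)"
      using \<delta> by (simp add: powr_minus field_simps)
    finally show ?thesis .
  qed
  ultimately show "\<exists>n. coverable \<delta> n {0..<1::real} \<and> real n \<le> 2 * \<delta> powr (- 1)"
    using coverable_grid[of \<delta> "{0..<1}"] \<delta> by blast
qed simp

text \<open>The factor \<open>CARD('n)\<close> comes from estimating the Euclidean norm by the sum
  of the absolute values of the coordinates.\<close>

lemma coverable_box:
  fixes B :: "'n::finite \<Rightarrow> real set"
  assumes "\<And>i. coverable \<delta> (n i) (B i)"
  shows "coverable (real CARD('n) * \<delta>) (\<Prod>i\<in>UNIV. n i) {x :: real^'n. \<forall>i. x $ i \<in> B i}"
proof -
  from assms have "\<exists>F. finite F \<and> card F \<le> n i \<and> B i \<subseteq> \<Union>F \<and> (\<forall>U\<in>F. \<forall>x\<in>U. \<forall>y\<in>U. dist x y \<le> \<delta>)" for i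
    by (simp add: coverable_def)
  then obtain F where F: "\<And>i. finite (F i)" "\<And>i. card (F i) \<le> n i" "\<And>i. B i \<subseteq> \<Union>(F i)"
    "\<And>i U x y. U \<in> F i \<Longrightarrow> x \<in> U \<Longrightarrow> y \<in> U \<Longrightarrow> dist x y \<le> \<delta>"
    by metis
  define G where "G = (\<lambda>V. {x :: real^'n. \<forall>i. x $ i \<in> V i}) ` PiE UNIV F"
  have fin: "finite (PiE UNIV F)" using F(1) by (intro finite_PiE) auto
  then have "finite G" by (simp add: G_def)
  moreover have "card G \<le> (\<Prod>i\<in>UNIV. n i)"
  proof -
    have "card G \<le> card (PiE UNIV F)"
      unfolding G_def by (rule card_image_le[OF fin])
    also have "\<dots> = (\<Prod>i\<in>UNIV. card (F i))" by (simp add: card_PiE)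
    also have "\<dots> \<le> (\<Prod>i\<in>UNIV. n i)" by (intro prod_mono) (simp add: F(2))
    finally show ?thesis .
  qed
  moreover have "{x :: real^'n. \<forall>i. x $ i \<in> B i} \<subseteq> \<Union>G"
  proof
    fix x :: "real^'n" assume "x \<in> {x. \<forall>i. x $ i \<in> B i}"
    then have "\<forall>i. \<exists>U\<in>F i. x $ i \<in> U" using F(3) by blast
    then obtain V where V: "\<And>i. V i \<in> F i \<and> x $ i \<in> V i" by metis
    then show "x \<in> \<Union>G" by (auto simp: G_def)
  qed
  moreover have "dist x y \<le> real CARD('n) * \<delta>" if "U \<in> G" "x \<in> U" "y \<in> U" for U x y
  proof -
    obtain V where V: "V \<in> PiE UNIV F" "U = {x. \<forall>i. x $ i \<in> V i}"
      using \<open>U \<in> G\<close> by (auto simp: G_def)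
    have "\<bar>(x - y) $ i\<bar> \<le> \<delta>" for i
      using F(4)[of "V i" i "x $ i" "y $ i"] V that by (auto simp: dist_real_def PiE_iff)
    then have "(\<Sum>i\<in>UNIV. \<bar>(x - y) $ i\<bar>) \<le> (\<Sum>i\<in>(UNIV :: 'n set). \<delta>)"
      by (intro sum_mono)
    then show ?thesis
      using norm_le_l1_cart[of "x - y"] by (simp add: dist_norm)
  qed
  ultimately show ?thesis
    unfolding coverable_def by blast
qed

lemma box_bounded_box:
  fixes B :: "'n::finite \<Rightarrow> real set"
  assumes "\<And>i. box_bounded (t i) (B i)"
  shows "box_bounded (\<Sum>i\<in>UNIV. t i) {x :: real^'n. \<forall>i. x $ i \<in> B i}"
proof -
  from assms obtain C where C: "\<And>i. 0 \<le> C i"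
    "\<And>i \<delta>. 0 < \<delta> \<Longrightarrow> \<delta> \<le> 1 \<Longrightarrow> \<exists>n. coverable \<delta> n (B i) \<and> real n \<le> C i * \<delta> powr (- t i)"
    unfolding box_bounded_def by metis
  define m where "m = real CARD('n)"
  have m: "1 \<le> m" by (simp add: m_def Suc_leI)
  show ?thesis
    unfolding box_bounded_def
  proof (rule exI, intro conjI allI impI)
    show "0 \<le> (\<Prod>i\<in>UNIV. C i * (1 / m) powr (- t i))"
      using C(1) by (intro prod_nonneg) auto
    fix \<delta> :: real assume \<delta>: "0 < \<delta> \<and> \<delta> \<le> 1"
    \<comment> \<open>The factors are covered at scale \<delta> / m to offset the factor m in the
      diameter of a box.\<close>
    then have d: "0 < \<delta> / m" "\<delta> / m \<le> 1"
      using m by (auto simp: field_simps)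
    obtain n where n: "\<And>i. coverable (\<delta> / m) (n i) (B i)" "\<And>i. real (n i) \<le> C i * (\<delta> / m) powr (- t i)"
      using C(2)[OF d] by metis
    have "coverable \<delta> (\<Prod>i\<in>UNIV. n i) {x :: real^'n. \<forall>i. x $ i \<in> B i}"
      using coverable_box[where B = B and n = n and \<delta> = "\<delta> / m", OF n(1)] m by (simp add: m_def)
    moreover have "real (\<Prod>i\<in>UNIV. n i) \<le> (\<Prod>i\<in>UNIV. C i * (1 / m) powr (- t i)) * \<delta> powr (- (\<Sum>i\<in>UNIV. t i))"
    proof -
      have "real (\<Prod>i\<in>UNIV. n i) \<le> (\<Prod>i\<in>UNIV. C i * (\<delta> / m) powr (- t i))"
        unfolding of_nat_prod by (intro prod_mono) (simp add: n(2))
      also have "\<dots> = (\<Prod>i\<in>UNIV. C i * (1 / m) powr (- t i) * \<delta> powr (- t i))"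
      proof (rule prod.cong)
        fix i
        have "(\<delta> / m) powr (- t i) = ((1 / m) * \<delta>) powr (- t i)" by simp
        also have "\<dots> = (1 / m) powr (- t i) * \<delta> powr (- t i)"
          by (rule powr_mult)
        finally show "C i * (\<delta> / m) powr (- t i) = C i * (1 / m) powr (- t i) * \<delta> powr (- t i)"
          by simp
      qed simp
      also have "\<dots> = (\<Prod>i\<in>UNIV. C i * (1 / m) powr (- t i)) * (\<Prod>i\<in>UNIV. \<delta> powr (- t i))"
        by (rule prod.distrib)
      also have "(\<Prod>i\<in>UNIV. \<delta> powr (- t i)) = \<delta> powr (- (\<Sum>i\<in>UNIV. t i))"
        using \<delta> by (simp add: powr_sum sum_negf[symmetric])
      finally show ?thesis .
    qed
    ultimately show "\<exists>n. coverable \<delta> n {x :: real^'n. \<forall>i. x $ i \<in> B i} \<and>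
        real n \<le> (\<Prod>i\<in>UNIV. C i * (1 / m) powr (- t i)) * \<delta> powr (- (\<Sum>i\<in>UNIV. t i))"
      by blast
  qed
qed

text \<open>Each covering set \<open>U j\<close> of factor \<open>k\<close> is multiplied by a box cover of the other factors at the
  same scale \<open>d j\<close>; the auxiliary \<open>e' j\<close> keep these scales positive when \<open>U j\<close> is a point.\<close>

lemma hausdorff_measure_box_null:
  fixes B :: "'n::finite \<Rightarrow> real set"
  assumes "hausdorff_measure s (B k) = 0" "0 < s"
    and box: "\<And>i. i \<noteq> k \<Longrightarrow> box_bounded (t i) (B i)" and t: "\<And>i. 0 \<le> t i"
  shows "hausdorff_measure (s + (\<Sum>i\<in>UNIV - {k}. t i)) {x :: real^'n. \<forall>i. x $ i \<in> B i} = 0"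
  unfolding hausdorff_measure_eq_0_iff
proof (intro allI impI)
  fix \<delta> :: real assume \<delta>: "0 < \<delta>"
  define \<tau> where "\<tau> = (\<Sum>i\<in>UNIV - {k}. t i)"
  have \<tau>: "0 \<le> \<tau>" using t by (auto simp: \<tau>_def intro: sum_nonneg)
  have "\<exists>C. \<forall>i. i \<noteq> k \<longrightarrow> 0 \<le> C i \<and> (\<forall>\<delta>. 0 < \<delta> \<and> \<delta> \<le> 1 \<longrightarrow> (\<exists>n. coverable \<delta> n (B i) \<and> real n \<le> C i * \<delta> powr (- t i)))"
    using box unfolding box_bounded_def by metis
  then obtain C where C: "\<And>i. i \<noteq> k \<Longrightarrow> 0 \<le> C i"
    "\<And>i \<delta>. i \<noteq> k \<Longrightarrow> 0 < \<delta> \<Longrightarrow> \<delta> \<le> 1 \<Longrightarrow> \<exists>n. coverable \<delta> n (B i) \<and> real n \<le> C i * \<delta> powr (- t i)"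
    by blast
  define m where "m = real CARD('n)"
  have m: "1 \<le> m" by (simp add: m_def Suc_leI)
  define c where "c = (\<Prod>i\<in>UNIV - {k}. C i) * m powr (s + \<tau>)"
  have c: "0 \<le> c" using C(1) by (auto simp: c_def intro!: mult_nonneg_nonneg prod_nonneg)
  \<comment> \<open>Below \<open>d0\<close> the box covers are available, which need scales up to 1,
    and boxes of diameter m d stay within \<delta>.\<close>
  define d0 where "d0 = min 1 (\<delta> / m)"
  have d0: "0 < d0" "d0 \<le> 1" "m * d0 \<le> \<delta>"
    using \<delta> m by (auto simp: d0_def min_def field_simps)
  \<comment> \<open>The number of boxes is of order d^(-\<tau>) and their diameter at most m d, so
    in the exponent s + \<tau> exactly d^s remains.\<close>
  have scale: "hausdorff_pre (s + \<tau>) \<delta> {x :: real^'n. \<forall>i. x $ i \<in> (if i = k then V else B i)} \<le> ennreal (c * d powr s)"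
    if d: "0 < d" "d \<le> d0" and V: "\<And>x y. x \<in> V \<Longrightarrow> y \<in> V \<Longrightarrow> dist x y \<le> d" for d V
  proof -
    have "\<exists>n. \<forall>i. i \<noteq> k \<longrightarrow> coverable d (n i) (B i) \<and> real (n i) \<le> C i * d powr (- t i)"
      using C(2)[of _ d] d d0 by (metis order_trans)
    then obtain n where n: "\<And>i. i \<noteq> k \<Longrightarrow> coverable d (n i) (B i) \<and> real (n i) \<le> C i * d powr (- t i)"
      by blast
    define n' where "n' i = (if i = k then 1 else n i)" for i
    have "coverable d 1 V"
      unfolding coverable_def using V by (intro exI[of _ "{V}"]) auto
    then have "coverable d (n' i) (if i = k then V else B i)" for i
      using n by (simp add: n'_def)
    then have cov: "coverable (m * d) (\<Prod>i\<in>UNIV. n' i) {x :: real^'n. \<forall>i. x $ i \<in> (if i = k then V else B i)}"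
      unfolding m_def by (rule coverable_box)
    have "m * d \<le> m * d0" using d m by (intro mult_left_mono) auto
    then have md: "0 \<le> m * d" "m * d \<le> \<delta>"
      using d d0(3) m by (simp, meson order_trans)
    have "(\<Prod>i\<in>UNIV. n' i) = (\<Prod>i\<in>UNIV - {k}. n i)"
      by (subst prod.remove[of UNIV k]) (auto simp: n'_def intro!: prod.cong)
    then have "real (\<Prod>i\<in>UNIV. n' i) = (\<Prod>i\<in>UNIV - {k}. real (n i))" by simp
    also have "\<dots> \<le> (\<Prod>i\<in>UNIV - {k}. C i * d powr (- t i))"
      using n by (intro prod_mono) auto
    also have "\<dots> = (\<Prod>i\<in>UNIV - {k}. C i) * d powr (- \<tau>)"
      using d by (simp add: prod.distrib powr_sum \<tau>_def sum_negf[symmetric])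
    finally have "real (\<Prod>i\<in>UNIV. n' i) * (m * d) powr (s + \<tau>) \<le>
        (\<Prod>i\<in>UNIV - {k}. C i) * d powr (- \<tau>) * (m * d) powr (s + \<tau>)"
      by (rule mult_right_mono) simp
    also have "\<dots> = c * d powr s"
    proof -
      have "(m * d) powr (s + \<tau>) = m powr (s + \<tau>) * d powr (s + \<tau>)"
        by (rule powr_mult)
      moreover have "d powr (- \<tau>) * d powr (s + \<tau>) = d powr s"
        by (simp flip: powr_add)
      ultimately show ?thesis
        by (simp add: c_def algebra_simps)
    qed
    finally have le: "real (\<Prod>i\<in>UNIV. n' i) * (m * d) powr (s + \<tau>) \<le> c * d powr s" .
    show ?thesis
      using hausdorff_pre_le_coverable[OF cov md, of "s + \<tau>"] \<tau> assms(2) ennreal_leI[OF le]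
      by (auto intro: order_trans)
  qed
  have "hausdorff_pre (s + \<tau>) \<delta> {x :: real^'n. \<forall>i. x $ i \<in> B i} \<le> ennreal (2 * c * e)" if e: "0 < e" for e
  proof -
    have "hausdorff_pre s d0 (B k) = 0"
      using assms(1) d0 hausdorff_measure_eq_0_iff by blast
    then have "hausdorff_pre s d0 (B k) < ennreal e"
      using e by simp
    then obtain U where U: "B k \<subseteq> (\<Union>j. U j)" "\<And>j. bounded (U j) \<and> diameter (U j) \<le> d0"
      "(\<Sum>j. ennreal (diameter (U j) powr s)) < ennreal e"
      unfolding hausdorff_pre_def INF_less_iff by blast
    define e' where "e' j = min d0 ((e * (1 / 2) ^ Suc j) powr (1 / s))" for j :: nat
    have e': "0 < e' j" "e' j \<le> d0" "e' j powr s \<le> e * (1 / 2) ^ Suc j" for j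
    proof -
      show "0 < e' j" "e' j \<le> d0" using e d0 by (auto simp: e'_def)
      have "e' j powr s \<le> ((e * (1 / 2) ^ Suc j) powr (1 / s)) powr s"
        using \<open>0 < e' j\<close> assms(2) by (intro powr_mono2) (auto simp: e'_def)
      also have "\<dots> = e * (1 / 2) ^ Suc j"
        using assms(2) e by (simp add: powr_powr)
      finally show "e' j powr s \<le> e * (1 / 2) ^ Suc j" .
    qed
    define d where "d j = max (diameter (U j)) (e' j)" for j
    have d: "0 < d j" "d j \<le> d0" "d j powr s \<le> diameter (U j) powr s + e * (1 / 2) ^ Suc j" for j
    proof -
      show "0 < d j" "d j \<le> d0" using e'[of j] U(2)[of j] by (auto simp: d_def)
      have "0 \<le> diameter (U j) powr s" "0 \<le> e * (1 / 2) ^ Suc j" using e by auto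
      moreover have "d j = e' j \<or> d j = diameter (U j)"
        by (auto simp: d_def)
      ultimately show "d j powr s \<le> diameter (U j) powr s + e * (1 / 2) ^ Suc j"
        using e'(3)[of j] by (elim disjE; simp only:; linarith)
    qed
    have "{x :: real^'n. \<forall>i. x $ i \<in> B i} \<subseteq> (\<Union>j. {x. \<forall>i. x $ i \<in> (if i = k then U j else B i)})"
    proof
      fix x :: "real^'n" assume x: "x \<in> {x. \<forall>i. x $ i \<in> B i}"
      then obtain j where "x $ k \<in> U j" using U(1) by blast
      then show "x \<in> (\<Union>j. {x. \<forall>i. x $ i \<in> (if i = k then U j else B i)})"
        using x by auto
    qed
    then have "hausdorff_pre (s + \<tau>) \<delta> {x :: real^'n. \<forall>i. x $ i \<in> B i} \<le>
        (\<Sum>j. hausdorff_pre (s + \<tau>) \<delta> {x :: real^'n. \<forall>i. x $ i \<in> (if i = k then U j else B i)})"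
      by (rule order_trans[OF hausdorff_pre_mono hausdorff_pre_UN_le])
    also have "\<dots> \<le> (\<Sum>j. ennreal c * (ennreal (diameter (U j) powr s) + ennreal (e * (1 / 2) ^ Suc j)))"
    proof (intro suminf_le)
      fix j
      have "hausdorff_pre (s + \<tau>) \<delta> {x :: real^'n. \<forall>i. x $ i \<in> (if i = k then U j else B i)} \<le> ennreal (c * d j powr s)"
      proof (rule scale[OF d(1,2)])
        show "dist x y \<le> d j" if "x \<in> U j" "y \<in> U j" for x y
          using diameter_bounded_bound[OF _ that] U(2)[of j] unfolding d_def by linarith
      qed
      also have "\<dots> \<le> ennreal (c * (diameter (U j) powr s + e * (1 / 2) ^ Suc j))"
        using c d(3)[of j] by (intro ennreal_leI mult_left_mono)
      also have "\<dots> = ennreal c * (ennreal (diameter (U j) powr s) + ennreal (e * (1 / 2) ^ Suc j))"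
        using c e by (simp add: ennreal_mult ennreal_plus)
      finally show "hausdorff_pre (s + \<tau>) \<delta> {x :: real^'n. \<forall>i. x $ i \<in> (if i = k then U j else B i)} \<le>
          ennreal c * (ennreal (diameter (U j) powr s) + ennreal (e * (1 / 2) ^ Suc j))" .
    qed auto
    also have "\<dots> = ennreal c * ((\<Sum>j. ennreal (diameter (U j) powr s)) + (\<Sum>j. ennreal (e * (1 / 2) ^ Suc j)))"
      by (simp only: ennreal_suminf_cmult suminf_add[OF summableI summableI])
    also have "\<dots> \<le> ennreal c * (ennreal e + ennreal e)"
      unfolding suminf_half_ennreal[OF less_imp_le[OF e]] using U(3)
      by (intro mult_left_mono add_mono) auto
    also have "\<dots> = ennreal (2 * c * e)"
      using c e by (simp flip: ennreal_plus ennreal_mult)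
    finally show ?thesis .
  qed
  note * = this
  have "hausdorff_pre (s + \<tau>) \<delta> {x :: real^'n. \<forall>i. x $ i \<in> B i} \<le> 0"
  proof (rule ennreal_le_epsilon)
    fix e :: real assume e: "0 < e"
    \<comment> \<open>The 1 in the denominator covers the case \<open>c = 0\<close>.\<close>
    have "2 * c * (e / (2 * c + 1)) \<le> e"
      using c e by (simp add: field_simps)
    then have "ennreal (2 * c * (e / (2 * c + 1))) \<le> ennreal e"
      by (rule ennreal_leI)
    moreover have "hausdorff_pre (s + \<tau>) \<delta> {x :: real^'n. \<forall>i. x $ i \<in> B i} \<le> ennreal (2 * c * (e / (2 * c + 1)))"
      using c e by (intro *) auto
    ultimately show "hausdorff_pre (s + \<tau>) \<delta> {x :: real^'n. \<forall>i. x $ i \<in> B i} \<le> 0 + ennreal e"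
      by simp
  qed
  then show "hausdorff_pre (s + (\<Sum>i\<in>UNIV - {k}. t i)) \<delta> {x :: real^'n. \<forall>i. x $ i \<in> B i} = 0"
    by (simp add: \<tau>_def)
qed

text \<open>Factor \<open>k\<close> stays whole while the others are cut into countably many pieces;
  this is harmless since Hausdorff null sets are closed under countable unions.\<close>

lemma dimH_box_le:
  fixes P :: "(real^'n::finite) set" and B :: "nat \<Rightarrow> 'n \<Rightarrow> real set"
  assumes "P \<subseteq> (\<Union>n. {x. \<forall>i. x $ i \<in> B n i})" "\<And>n. B n k = A"
    "\<And>n i. i \<noteq> k \<Longrightarrow> box_bounded (t i) (B n i)" "\<And>i. 0 \<le> t i"
  shows "dimH P \<le> dimH A + ereal (\<Sum>i\<in>UNIV - {k}. t i)"
proof -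
  let ?\<tau> = "\<Sum>i\<in>UNIV - {k}. t i"
  have \<tau>: "0 \<le> ?\<tau>" using assms(4) by (auto intro: sum_nonneg)
  have "dimH P - ereal ?\<tau> \<le> dimH A"
    unfolding dimH_def[of A]
  proof (rule INF_greatest)
    fix s assume "s \<in> {s. 0 < s \<and> hausdorff_measure s A = 0}"
    then have s: "0 < s" "hausdorff_measure s A = 0" by auto
    have "hausdorff_measure (s + ?\<tau>) P = 0"
      by (rule hausdorff_measure_UN_null[OF hausdorff_measure_box_null assms(1)]) (use s assms in auto)
    then have "dimH P \<le> ereal (s + ?\<tau>)"
      unfolding dimH_def using s \<tau> by (intro INF_lower) auto
    then show "dimH P - ereal ?\<tau> \<le> ereal s"
      by (simp add: ereal_minus_le)
  qed
  then show ?thesis by (simp add: ereal_minus_le)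
qed

lemma dimP_box_le:
  fixes P :: "(real^'n::finite) set" and B :: "nat \<Rightarrow> 'n \<Rightarrow> real set"
  assumes "P \<subseteq> (\<Union>n. {x. \<forall>i. x $ i \<in> B n i})" "\<And>n i. box_bounded (t i) (B n i)" "\<And>i. 0 \<le> t i"
  shows "dimP P \<le> ereal (\<Sum>i\<in>UNIV. t i)"
  by (rule dimP_le_box[OF assms(1)]) (use assms in \<open>auto intro!: box_bounded_box sum_nonneg\<close>)

section \<open>Badly approximable numbers\<close>

text \<open>The cap \<open>h\<close> accommodates the finitely many denominators for which only some
  positive distance is known. It limits the scale from which holes appear, but not their relative
  size.\<close>

definition gap_set :: "real \<Rightarrow> real \<Rightarrow> real set" where
  "gap_set \<epsilon> h = {x. 0 \<le> x \<and> x < 1 \<and>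
     (\<forall>q::nat. 1 \<le> q \<longrightarrow> (\<forall>p::int. min (\<epsilon> / (real q)\<^sup>2) h \<le> \<bar>x - of_int p / real q\<bar>))}"

text \<open>By Dirichlet, the midpoint \<open>y\<close> has an approximation \<open>p/q\<close> with \<open>q \<le> N\<close>, where \<open>N\<^sup>2 \<eta>\<close> is
  comparable to \<open>1/\<epsilon>\<close>. Either \<open>y\<close> is deep inside the excluded interval around \<open>p/q\<close>, or \<open>q\<close> is
  comparable to \<open>N\<close> and \<open>p/q\<close> itself is close to \<open>y\<close>.\<close>

lemma gap_set_hole:
  assumes \<epsilon>: "0 < \<epsilon>" "\<epsilon> \<le> 1" and h: "0 < h" "h \<le> 1" and l: "0 < \<eta>" "\<eta> \<le> \<epsilon> * h\<^sup>2"
  shows "\<exists>z. \<bar>z - y\<bar> \<le> \<eta> / 4 \<and> (\<forall>x\<in>gap_set \<epsilon> h. \<epsilon>\<^sup>2 * \<eta> / 64 \<le> \<bar>x - z\<bar>)"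
proof -
  \<comment> \<open>The 8 makes 2 / (\<epsilon> N^2) at most \<eta> / 4 in the second case; rounding
    up at most doubles the root, hence 32 in the upper bound for N^2.\<close>
  define N where "N = nat \<lceil>sqrt (8 / (\<epsilon> * \<eta>))\<rceil>"
  have el: "0 < \<epsilon> * \<eta>" using \<epsilon> l by simp
  have l1: "\<epsilon> * \<eta> \<le> 1"
  proof -
    have "\<epsilon> * \<eta> \<le> 1 * (\<epsilon> * h\<^sup>2)" using \<epsilon> l by (intro mult_mono) auto
    also have "\<dots> \<le> 1 * (1 * 1)" using \<epsilon> h by (intro mult_mono power_le_one) auto
    finally show ?thesis by simp
  qed
  have ge: "sqrt (8 / (\<epsilon> * \<eta>)) \<le> N" by (simp add: N_def le_of_int_ceiling of_nat_ceiling)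
  have "1 \<le> sqrt (8 / (\<epsilon> * \<eta>))" using el l1 by (simp add: field_simps)
  then have le: "real N \<le> 2 * sqrt (8 / (\<epsilon> * \<eta>))" unfolding N_def by linarith
  have N0: "0 < real N" using \<open>1 \<le> sqrt (8 / (\<epsilon> * \<eta>))\<close> ge by linarith
  have N2: "8 / (\<epsilon> * \<eta>) \<le> (real N)\<^sup>2" "(real N)\<^sup>2 \<le> 32 / (\<epsilon> * \<eta>)"
  proof -
    have "(sqrt (8 / (\<epsilon> * \<eta>)))\<^sup>2 \<le> (real N)\<^sup>2" using ge el by (intro power_mono) auto
    then show "8 / (\<epsilon> * \<eta>) \<le> (real N)\<^sup>2" using el by simp
    have "(real N)\<^sup>2 \<le> (2 * sqrt (8 / (\<epsilon> * \<eta>)))\<^sup>2" using le by (intro power_mono) auto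
    also have "\<dots> = 32 / (\<epsilon> * \<eta>)" using el by (simp add: power_mult_distrib)
    finally show "(real N)\<^sup>2 \<le> 32 / (\<epsilon> * \<eta>)" .
  qed
  have NL: "\<epsilon> * \<eta> / 32 \<le> 1 / (real N)\<^sup>2" "1 / (real N)\<^sup>2 \<le> \<epsilon> * \<eta> / 8"
    using N2 el N0 by (auto simp: field_simps)
  \<comment> \<open>Ensures that in the second case the cap \<open>h\<close> is not the smaller term
    in \<rho>.\<close>
  have Nh: "2 / h < N"
  proof -
    have "(2 / h)\<^sup>2 < 8 / (\<epsilon> * \<eta>)"
    proof -
      have "\<epsilon> * \<eta> \<le> 1 * h\<^sup>2"
      proof (rule order_trans)
        show "\<epsilon> * \<eta> \<le> 1 * \<eta>" using \<epsilon> l by (intro mult_right_mono) auto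
        have "\<epsilon> * h\<^sup>2 \<le> 1 * h\<^sup>2" using \<epsilon> by (intro mult_right_mono) auto
        then show "1 * \<eta> \<le> 1 * h\<^sup>2" using l by simp
      qed
      then have "8 / h\<^sup>2 \<le> 8 / (\<epsilon> * \<eta>)" using el h by (intro divide_left_mono) auto
      moreover have "(2 / h)\<^sup>2 < 8 / h\<^sup>2" using h by (simp add: power_divide divide_strict_right_mono)
      ultimately show ?thesis by linarith
    qed
    then have "(2 / h)\<^sup>2 < (real N)\<^sup>2" using N2(1) by linarith
    then show ?thesis using N0 by (simp add: power2_less_imp_less)
  qed
  obtain a k where k: "0 < k" "k \<le> int N" "\<bar>of_int k * y - of_int a\<bar> < 1 / N"
    by (rule Dirichlet_approx[of N y]) (use N0 in auto)
  define q where "q = nat k"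
  have q: "1 \<le> q" "q \<le> N" "real_of_int k = real q" using k by (auto simp: q_def)
  define p where "p = of_int a / real q"
  have yp: "\<bar>y - p\<bar> < 1 / (q * N)"
  proof -
    have "\<bar>y - p\<bar> = \<bar>q * y - a\<bar> / q"
      using q(1) by (simp add: p_def field_simps abs_divide flip: abs_mult)
    also have "\<dots> < (1 / N) / q"
      using k(3) q by (intro divide_strict_right_mono) auto
    finally show ?thesis by (simp add: mult.commute)
  qed
  define \<rho> where "\<rho> = min (\<epsilon> / (real q)\<^sup>2) h"
  have excl: "\<rho> \<le> \<bar>x - p\<bar>" if "x \<in> gap_set \<epsilon> h" for x
    using that q(1) by (simp add: gap_set_def \<rho>_def p_def)
  have qN: "(real q)\<^sup>2 \<le> (real N)\<^sup>2" using q by (intro power_mono) auto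
  have eN: "\<epsilon> / (real N)\<^sup>2 \<le> \<rho>"
  proof -
    have "\<epsilon> / (real N)\<^sup>2 \<le> \<epsilon> / (real q)\<^sup>2"
      using qN q \<epsilon> by (intro divide_left_mono) auto
    moreover have "\<epsilon> / (real N)\<^sup>2 \<le> h"
    proof -
      have "\<epsilon> * (1 / (real N)\<^sup>2) \<le> 1 * (\<epsilon> * \<eta> / 8)" using NL \<epsilon> by (intro mult_mono) auto
      also have "\<dots> \<le> \<eta>" using mult_right_mono[OF \<epsilon>(2), of \<eta>] l by linarith
      also have "\<dots> \<le> 1 * h * 1"
      proof -
        have "\<epsilon> * h\<^sup>2 \<le> 1 * (h * 1)" unfolding power2_eq_square using \<epsilon> h by (intro mult_mono) auto
        then show ?thesis using l by simp
      qed
      finally show ?thesis by simp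
    qed
    ultimately show ?thesis by (simp add: \<rho>_def)
  qed
  \<comment> \<open>The excluded radius is at least \<epsilon> / N^2 \<ge> \<epsilon>^2 \<eta> / 32,
    and half of it is kept as the size of the hole.\<close>
  have half: "\<epsilon>\<^sup>2 * \<eta> / 64 \<le> \<rho> / 2"
  proof -
    have "\<epsilon> * (\<epsilon> * \<eta> / 32) \<le> \<epsilon> * (1 / (real N)\<^sup>2)" using NL \<epsilon> by (intro mult_left_mono) auto
    moreover have "\<epsilon> * (\<epsilon> * \<eta> / 32) = \<epsilon>\<^sup>2 * \<eta> / 32" "\<epsilon> * (1 / (real N)\<^sup>2) = \<epsilon> / (real N)\<^sup>2"
      by (simp_all add: power2_eq_square)
    ultimately show ?thesis using eN by linarith
  qed
  show ?thesis
  proof (cases "\<bar>y - p\<bar> \<le> \<rho> / 2")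
    case True
    have "\<epsilon>\<^sup>2 * \<eta> / 64 \<le> \<bar>x - y\<bar>" if "x \<in> gap_set \<epsilon> h" for x
      using excl[OF that] True half by linarith
    then show ?thesis using l by (intro exI[of _ y]) auto
  next
    case False
    then have far: "\<rho> / 2 < 1 / (q * N)" using yp by linarith
    have "1 / (q * N) \<le> 1 / N" using q N0 by (simp add: field_simps)
    moreover have "1 / N < h / 2" using Nh N0 h by (simp add: field_simps)
    ultimately have "\<rho> < h" using far by linarith
    then have "\<rho> = \<epsilon> / (real q)\<^sup>2" by (auto simp: \<rho>_def min_def split: if_splits)
    then have "\<epsilon> / (real q)\<^sup>2 / 2 < 1 / (q * N)" using far by simp
    then have "\<epsilon> * N < 2 * q"
      using q N0 by (simp add: field_simps power2_eq_square)
    then have "1 / (q * N) < 2 / (\<epsilon> * (real N)\<^sup>2)"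
      using q N0 \<epsilon> by (simp add: field_simps power2_eq_square)
    also have "\<dots> = 2 / \<epsilon> * (1 / (real N)\<^sup>2)" by simp
    also have "\<dots> \<le> 2 / \<epsilon> * (\<epsilon> * \<eta> / 8)" using NL \<epsilon> by (intro mult_left_mono) auto
    also have "\<dots> = \<eta> / 4" using \<epsilon> by simp
    finally have "\<bar>p - y\<bar> \<le> \<eta> / 4" using yp by linarith
    moreover have "\<epsilon>\<^sup>2 * \<eta> / 64 \<le> \<bar>x - p\<bar>" if "x \<in> gap_set \<epsilon> h" for x
    proof -
      have "0 < \<rho>" using \<epsilon> h q by (auto simp: \<rho>_def)
      then show ?thesis using excl[OF that] half by linarith
    qed
    ultimately show ?thesis by blast
  qed
qed

text \<open>For \<open>y\<close> the midpoint of a cell, the subcell containing \<open>z\<close> is missed by \<open>A\<close>.\<close>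

lemma card_subgrid_le:
  fixes A :: "real set" and M :: nat
  assumes "0 < h" "1 \<le> M" and fin: "finite ((\<lambda>x. \<lfloor>x / h\<rfloor>) ` A)"
    and hole: "\<And>y. \<exists>z. \<bar>z - y\<bar> \<le> h / 4 \<and> (\<forall>x\<in>A. h / M \<le> \<bar>x - z\<bar>)"
  shows "finite ((\<lambda>x. \<lfloor>x / (h / M)\<rfloor>) ` A) \<and>
    card ((\<lambda>x. \<lfloor>x / (h / M)\<rfloor>) ` A) \<le> (M - 1) * card ((\<lambda>x. \<lfloor>x / h\<rfloor>) ` A)"
proof -
  define J where "J = (\<lambda>x. \<lfloor>x / h\<rfloor>) ` A"
  obtain z where z: "\<And>y. \<bar>z y - y\<bar> \<le> h / 4" "\<And>y x. x \<in> A \<Longrightarrow> h / M \<le> \<bar>x - z y\<bar>"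
    using hole by metis
  \<comment> \<open>The subcell hit by the hole of cell \<open>j\<close>. Its centre is within h/4
    of the midpoint of the cell, so the subcell lies in the same cell.\<close>
  define c where "c j = \<lfloor>z ((of_int j + 1 / 2) * h) / (h / M)\<rfloor>" for j
  define K where "K j = {j * int M..<(j + 1) * int M} - {c j}" for j
  have cell: "c j \<in> {j * int M..<(j + 1) * int M}" for j
  proof -
    let ?z = "z ((of_int j + 1 / 2) * h)"
    have "?z / h - (of_int j + 1 / 2) = (?z - (of_int j + 1 / 2) * h) / h"
      using assms(1) by (simp add: diff_divide_distrib)
    then have "\<bar>?z / h - (of_int j + 1 / 2)\<bar> = \<bar>?z - (of_int j + 1 / 2) * h\<bar> / h"
      using assms(1) by (simp only: abs_divide abs_of_pos)
    also have "\<dots> \<le> h / 4 / h" using z(1) assms(1) by (intro divide_right_mono) auto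
    finally have "\<bar>?z / h - (of_int j + 1 / 2)\<bar> \<le> 1 / 4" using assms(1) by simp
    then have *: "of_int j \<le> ?z / h" "?z / h < of_int j + 1" unfolding abs_le_iff by linarith+
    have "of_int j * real M \<le> ?z / h * M" "?z / h * M < (of_int j + 1) * real M"
      using mult_right_mono[OF *(1), of "real M"] mult_strict_right_mono[OF *(2), of "real M"] assms(2) by linarith+
    moreover have "?z / h * M = ?z / (h / M)" by simp
    ultimately have "of_int (j * int M) \<le> ?z / (h / M)" "?z / (h / M) < of_int ((j + 1) * int M)"
      by simp_all
    then show ?thesis
      unfolding c_def by (simp add: le_floor_iff floor_less_iff del: of_int_mult of_int_add)
  qed
  have scale: "\<bar>a - c\<bar> < b" if "\<bar>a / b - c / b\<bar> < 1" "0 < b" for a b c :: real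
  proof -
    have "a / b - c / b = (a - c) / b" by (simp add: diff_divide_distrib)
    then have "\<bar>a - c\<bar> / b < 1" using that by (simp only: abs_divide abs_of_pos)
    then show ?thesis using that by simp
  qed
  have sub: "(\<lambda>x. \<lfloor>x / (h / M)\<rfloor>) ` A \<subseteq> (\<Union>j\<in>J. K j)"
  proof safe
    fix x assume x: "x \<in> A"
    define j where "j = \<lfloor>x / h\<rfloor>"
    have j: "of_int j \<le> x / h" "x / h < of_int j + 1" by (auto simp: j_def)
    have "of_int j * real M \<le> x / h * M" "x / h * M < (of_int j + 1) * real M"
      using mult_right_mono[OF j(1), of "real M"] mult_strict_right_mono[OF j(2), of "real M"] assms(2) by linarith+
    moreover have "x / h * M = x / (h / M)" by simp
    ultimately have "of_int (j * int M) \<le> x / (h / M)" "x / (h / M) < of_int ((j + 1) * int M)"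
      by simp_all
    then have "\<lfloor>x / (h / M)\<rfloor> \<in> {j * int M..<(j + 1) * int M}"
      by (simp add: le_floor_iff floor_less_iff del: of_int_mult of_int_add)
    moreover have "\<lfloor>x / (h / M)\<rfloor> \<noteq> c j"
    proof
      assume "\<lfloor>x / (h / M)\<rfloor> = c j"
      then have "\<bar>x / (h / M) - z ((of_int j + 1 / 2) * h) / (h / M)\<bar> < 1"
        unfolding c_def by linarith
      moreover have "0 < h / M" using assms(1,2) by simp
      ultimately have "\<bar>x - z ((of_int j + 1 / 2) * h)\<bar> < h / M"
        by (rule scale)
      then show False using z(2)[OF x] by (meson not_le)
    qed
    ultimately show "\<lfloor>x / (h / M)\<rfloor> \<in> (\<Union>j\<in>J. K j)"
      using x by (auto simp: K_def J_def j_def)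
  qed
  have finJ: "finite J" using fin by (simp add: J_def)
  have finU: "finite (\<Union>j\<in>J. K j)" using finJ by (auto simp: K_def)
  have "card ((\<lambda>x. \<lfloor>x / (h / M)\<rfloor>) ` A) \<le> card (\<Union>j\<in>J. K j)"
    by (rule card_mono[OF finU sub])
  also have "\<dots> \<le> (\<Sum>j\<in>J. card (K j))" by (rule card_UN_le[OF finJ])
  also have "\<dots> = (\<Sum>j\<in>J. M - 1)"
    unfolding K_def using cell by (intro sum.cong refl) (simp add: card_Diff_singleton algebra_simps)
  also have "\<dots> = (M - 1) * card J" by simp
  finally show ?thesis
    using finite_subset[OF sub finU] unfolding J_def by blast
qed

text \<open>Each cell loses one of its \<open>M\<close> subcells at every subdivision, so order (M -
  1)^k cells of size l / M^k remain and the exponent is log_M (M - 1) < 1. Both \<open>M\<close> and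
  \<open>t\<close> are fixed before \<open>h\<close>, which affects only the starting scale and the
  constant.\<close>

lemma box_bounded_gap_set:
  assumes "0 < \<epsilon>"
  shows "\<exists>t\<ge>0. t < 1 \<and> (\<forall>h>0. box_bounded t (gap_set \<epsilon> h))"
proof -
  define \<epsilon>' where "\<epsilon>' = min \<epsilon> 1"
  have \<epsilon>': "0 < \<epsilon>'" "\<epsilon>' \<le> 1" "\<epsilon>' \<le> \<epsilon>" using assms by (auto simp: \<epsilon>'_def)
  \<comment> \<open>A subcell of length \<eta> / M must not be longer than the hole size
    \<epsilon>'^2 \<eta> / 64; the summand 2 gives M - 1 \<ge> 1, so
    \<open>t \<ge> 0\<close>.\<close>
  define M where "M = nat \<lceil>64 / \<epsilon>'\<^sup>2\<rceil> + 2"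
  have M: "2 \<le> M" "64 / \<epsilon>'\<^sup>2 \<le> M" by (simp_all add: M_def) linarith
  define t where "t = log M (M - 1)"
  have t: "0 \<le> t" "t < 1" and Mt: "real M powr t = M - 1"
    using M by (auto simp: t_def)
  have "box_bounded t (gap_set \<epsilon> h)" if h: "0 < h" for h
  proof -
    define h' where "h' = min h 1"
    have h': "0 < h'" "h' \<le> 1" "h' \<le> h" using h by (auto simp: h'_def)
    have sub: "gap_set \<epsilon> h \<subseteq> gap_set \<epsilon>' h'"
    proof
      fix x assume x: "x \<in> gap_set \<epsilon> h"
      have "min (\<epsilon>' / (real q)\<^sup>2) h' \<le> min (\<epsilon> / (real q)\<^sup>2) h" for q
        using \<epsilon>' h' by (intro min.mono divide_right_mono) auto
      then show "x \<in> gap_set \<epsilon>' h'"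
        using x unfolding gap_set_def mem_Collect_eq by (meson order_trans)
    qed
    define A where "A = gap_set \<epsilon>' h'"
    \<comment> \<open>The largest scale at which \<open>gap_set_hole\<close> applies.\<close>
    define l where "l = \<epsilon>' * h'\<^sup>2"
    have l: "0 < l" using \<epsilon>' h' by (simp add: l_def)
    define J where "J k = (\<lambda>x. \<lfloor>x / (l / M ^ k)\<rfloor>) ` A" for k :: nat
    define n0 where "n0 = card (J 0)"
    have J: "finite (J k) \<and> card (J k) \<le> n0 * (M - 1) ^ k" for k
    proof (induction k)
      case 0
      have "J 0 \<subseteq> {0..\<lfloor>1 / l\<rfloor>}"
        using l by (auto simp: J_def A_def gap_set_def intro!: floor_mono divide_right_mono)
      then show ?case by (auto simp: n0_def intro: finite_subset)
    next
      case (Suc k)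
      let ?h = "l / M ^ k"
      have hk: "0 < ?h" "?h \<le> l" using l M by (auto simp: divide_le_eq)
      have hole: "\<exists>z. \<bar>z - y\<bar> \<le> ?h / 4 \<and> (\<forall>x\<in>A. ?h / M \<le> \<bar>x - z\<bar>)" for y
      proof -
        obtain z where z: "\<bar>z - y\<bar> \<le> ?h / 4" "\<And>x. x \<in> A \<Longrightarrow> \<epsilon>'\<^sup>2 * ?h / 64 \<le> \<bar>x - z\<bar>"
          using gap_set_hole[OF \<epsilon>'(1,2) h'(1,2) hk(1)] hk(2) unfolding A_def l_def by blast
        have "1 / real M \<le> \<epsilon>'\<^sup>2 / 64"
          using M \<epsilon>' by (simp add: field_simps)
        then have "1 / real M * ?h \<le> \<epsilon>'\<^sup>2 / 64 * ?h"
          using hk by (intro mult_right_mono) auto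
        moreover have "?h / M = 1 / real M * ?h" "\<epsilon>'\<^sup>2 * ?h / 64 = \<epsilon>'\<^sup>2 / 64 * ?h" by simp_all
        ultimately have "?h / M \<le> \<epsilon>'\<^sup>2 * ?h / 64" by (simp only:)
        then show ?thesis using z by (meson order_trans)
      qed
      have "finite (J (Suc k)) \<and> card (J (Suc k)) \<le> (M - 1) * card (J k)"
        using card_subgrid_le[OF hk(1) _ _ hole] M Suc by (simp add: J_def mult.commute)
      moreover have "(M - 1) * card (J k) \<le> (M - 1) * (n0 * (M - 1) ^ k)"
        using Suc by (intro mult_left_mono) auto
      ultimately show ?case by (auto simp: algebra_simps intro: order_trans)
    qed
    have cov: "coverable (l / M ^ k) (n0 * (M - 1) ^ k) A" for k
    proof -
      have "coverable (l / M ^ k) (card (J k)) A"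
        unfolding J_def using J[of k] l M by (intro coverable_grid) (auto simp: J_def)
      then show ?thesis
        unfolding coverable_def using J[of k] by (meson order_trans)
    qed
    have "coverable \<delta> n (gap_set \<epsilon> h)" if "coverable \<delta>' n A" "\<delta>' \<le> \<delta>" for \<delta> \<delta>' n
      using that sub unfolding coverable_def A_def by (meson order_trans)
    note mono = this
    show ?thesis
      unfolding box_bounded_def
    proof (rule exI, intro conjI allI impI)
      \<comment> \<open>\<open>M powr t\<close> pays for rounding \<delta> down to a scale l / M^k;
        the summand 1 handles \<delta> \<ge> l, where nothing is subdivided.\<close>
      show "0 \<le> real n0 * real M powr t * (1 + l powr t)" by simp
      fix \<delta> :: real assume \<delta>: "0 < \<delta> \<and> \<delta> \<le> 1"
      have "\<exists>k. l / M ^ k \<le> \<delta>"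
      proof -
        obtain k where "(1 / real M) ^ k < \<delta> / l"
          using real_arch_pow_inv[of "\<delta> / l" "1 / real M"] \<delta> l M by auto
        then have "l / M ^ k \<le> \<delta>" using l M by (simp add: power_one_over field_simps)
        then show ?thesis ..
      qed
      define k where "k = (LEAST k. l / M ^ k \<le> \<delta>)"
      have k: "l / M ^ k \<le> \<delta>" unfolding k_def by (rule LeastI_ex) fact
      have "real ((M - 1) ^ k) = (real M ^ k) powr t"
      proof -
        have "real ((M - 1) ^ k) = (real M powr t) ^ k" using M by (simp add: Mt of_nat_diff)
        also have "\<dots> = (real M ^ k) powr t"
          using M by (simp add: powr_powr mult.commute flip: powr_realpow)
        finally show ?thesis .
      qed
      also have "\<dots> \<le> real M powr t * (1 + l powr t) * \<delta> powr (- t)"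
      proof (cases k)
        case 0
        have "1 \<le> real M powr t" "1 \<le> \<delta> powr (- t)"
          using M \<delta> t powr_mono2'[of "- t" \<delta> 1] by (auto simp: ge_one_powr_ge_zero)
        then have "1 * 1 * 1 \<le> real M powr t * (1 + l powr t) * \<delta> powr (- t)"
          by (intro mult_mono) auto
        then show ?thesis using 0 by simp
      next
        case (Suc j)
        have "\<not> l / M ^ j \<le> \<delta>"
          using not_less_Least[of j "\<lambda>k. l / M ^ k \<le> \<delta>"] Suc k_def by auto
        then have "real M ^ j \<le> l / \<delta>" using M \<delta> l by (simp add: field_simps)
        then have "real M ^ k \<le> M * (l / \<delta>)"
          unfolding Suc power_Suc by (rule mult_left_mono) simp
        then have "(real M ^ k) powr t \<le> (M * (l / \<delta>)) powr t"
          using t by (intro powr_mono2) auto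
        also have "\<dots> = real M powr t * l powr t * \<delta> powr (- t)"
          using l \<delta> by (simp add: powr_mult powr_divide powr_minus_divide)
        also have "\<dots> \<le> real M powr t * (1 + l powr t) * \<delta> powr (- t)"
          by (intro mult_right_mono mult_left_mono) auto
        finally show ?thesis .
      qed
      finally have "real (n0 * (M - 1) ^ k) \<le> real n0 * (real M powr t * (1 + l powr t) * \<delta> powr (- t))"
        unfolding of_nat_mult by (rule mult_left_mono) simp
      then show "\<exists>n. coverable \<delta> n (gap_set \<epsilon> h) \<and> real n \<le> real n0 * real M powr t * (1 + l powr t) * \<delta> powr (- t)"
        using mono[OF cov k] by (intro exI[of _ "n0 * (M - 1) ^ k"]) (simp add: mult.assoc)
    qed
  qed
  then show ?thesis using t by blast
qed

section \<open>The sets \<open>E \<psi>\<close> and their products\<close>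

lemma E_subset_unit: "E \<psi> \<subseteq> {0..<1}"
  by (auto simp: E_def W_def)

lemma E_finite_approximations:
  assumes "x \<in> E \<psi>" "0 < c" "c < 1"
  shows "finite {(p :: int, q :: nat). 1 \<le> q \<and> \<bar>x - of_int p / of_nat q\<bar> < c * \<psi> q}"
proof -
  have "x \<notin> W (\<lambda>q. c * \<psi> q)" "0 \<le> x" "x < 1"
    using assms by (auto simp: E_def W_def)
  then show ?thesis by (simp add: W_def)
qed

text \<open>A rational a/b equals (a n)/(b n) for every n. Since \<open>W\<close> counts pairs and
  not fractions, it would lie in \<open>W\<close> of \<psi>/2.\<close>

lemma E_irrational:
  assumes "x \<in> E \<psi>" "\<And>q. 1 \<le> q \<Longrightarrow> 0 < \<psi> q"
  shows "x \<notin> \<rat>"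
proof
  assume "x \<in> \<rat>"
  then obtain a b :: int where ab: "0 < b" "x = of_int a / of_int b"
    by (rule Rats_cases')
  let ?S = "{(p :: int, q :: nat). 1 \<le> q \<and> \<bar>x - of_int p / of_nat q\<bar> < 1 / 2 * \<psi> q}"
  let ?f = "\<lambda>n. (a * int (Suc n), nat b * Suc n)"
  have "?f n \<in> ?S" for n
  proof -
    have q: "1 \<le> nat b * Suc n" using ab(1) by simp
    have "real (nat b * Suc n) = of_int b * real (Suc n)"
      unfolding of_nat_mult using ab(1) by simp
    then have "of_int (a * int (Suc n)) / real (nat b * Suc n) = x"
      using ab by (simp del: of_nat_Suc)
    then show ?thesis using q assms(2)[OF q] by simp
  qed
  then have "range ?f \<subseteq> ?S" by blast
  moreover have "inj ?f"
    using ab(1) by (auto simp: inj_on_def)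
  ultimately have "infinite ?S"
    using range_inj_infinite infinite_super by blast
  then show False
    using E_finite_approximations[OF assms(1), of "1 / 2"] by simp
qed

lemma liminf_q2_nonneg:
  assumes "\<And>q. 1 \<le> q \<Longrightarrow> 0 < \<psi> q"
  shows "0 \<le> liminf_q2 \<psi>"
proof -
  have "0 \<le> (real q)\<^sup>2 * \<psi> q" for q
    using assms[of q] by (cases q) auto
  then show ?thesis
    unfolding liminf_q2_def by (intro Liminf_bounded) auto
qed

lemma less_liminf_q2_eventually:
  assumes "ereal b < liminf_q2 \<psi>"
  shows "\<exists>Q. \<forall>q\<ge>Q. b < (real q)\<^sup>2 * \<psi> q"
  using less_LiminfD[OF assms[unfolded liminf_q2_def]] by (simp add: eventually_sequentially)

text \<open>Exclusion from \<open>W\<close> of \<psi>/2 leaves finitely many pairs closer than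
  \<psi>(q)/2. Their distances are positive because \<open>x\<close> is irrational, and a small
  enough cap lies below them.\<close>

lemma E_subset_gap_sets:
  assumes pos: "\<And>q. 1 \<le> q \<Longrightarrow> 0 < \<psi> q" and b: "0 < b" "ereal b < liminf_q2 \<psi>"
  shows "E \<psi> \<subseteq> (\<Union>n. gap_set (b / 2) (inverse (real (Suc n))))"
proof
  fix x assume x: "x \<in> E \<psi>"
  obtain Q where Q: "\<And>q. Q \<le> q \<Longrightarrow> b < (real q)\<^sup>2 * \<psi> q"
    using less_liminf_q2_eventually[OF b(2)] by blast
  define S where "S = {(p :: int, q :: nat). 1 \<le> q \<and> \<bar>x - of_int p / of_nat q\<bar> < 1 / 2 * \<psi> q}"
  have S: "finite S"
    unfolding S_def using E_finite_approximations[OF x, of "1 / 2"] by simp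
  \<comment> \<open>The finitely many positive numbers the cap has to stay below; the 1 keeps the
    set nonempty.\<close>
  define D where "D = insert 1 ((\<lambda>(p, q). \<bar>x - of_int p / of_nat q\<bar>) ` S \<union> (\<lambda>q. 1 / 2 * \<psi> q) ` {1..<Q})"
  have D: "finite D" "D \<noteq> {}" using S by (auto simp: D_def)
  have "x \<noteq> of_int p / of_nat q" for p :: int and q :: nat
    using E_irrational[OF x pos] by (metis Rats_divide Rats_of_int Rats_of_nat)
  then have "\<forall>d\<in>D. 0 < d" using pos by (auto simp: D_def)
  then have "0 < Min D" using D by simp
  then obtain n where n: "inverse (real (Suc n)) < Min D" using reals_Archimedean by blast
  have "min (b / 2 / (real q)\<^sup>2) (inverse (real (Suc n))) \<le> \<bar>x - of_int p / real q\<bar>"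
    if q: "1 \<le> q" for p :: int and q :: nat
  proof -
    have *: "inverse (real (Suc n)) \<le> d" if "d \<in> D" for d
      using Min_le[OF D(1) that] n by linarith
    show ?thesis
    proof (cases "(p, q) \<in> S")
      case True
      then have "\<bar>x - of_int p / real q\<bar> \<in> D" unfolding D_def by force
      then show ?thesis using * min.coboundedI2 by blast
    next
      case False
      then have ge: "1 / 2 * \<psi> q \<le> \<bar>x - of_int p / real q\<bar>" using q by (auto simp: S_def)
      show ?thesis
      proof (cases "q < Q")
        case True
        then have "1 / 2 * \<psi> q \<in> D" using q by (auto simp: D_def)
        then have "inverse (real (Suc n)) \<le> 1 / 2 * \<psi> q" by (rule *)
        then show ?thesis using ge by (meson min.coboundedI2 order_trans)
      next
        case False
        then have "b / 2 / (real q)\<^sup>2 \<le> 1 / 2 * \<psi> q"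
          using Q[of q] q by (simp add: field_simps)
        then show ?thesis using ge by (meson min.coboundedI1 order_trans)
      qed
    qed
  qed
  then have "x \<in> gap_set (b / 2) (inverse (real (Suc n)))"
    unfolding gap_set_def using E_subset_unit x by fastforce
  then show "x \<in> (\<Union>n. gap_set (b / 2) (inverse (real (Suc n))))" by blast
qed

lemma E_box_bounded_cover:
  assumes pos: "\<And>q. 1 \<le> q \<Longrightarrow> 0 < \<psi> q" and "liminf_q2 \<psi> \<noteq> 0"
  shows "\<exists>t B. 0 \<le> t \<and> t < 1 \<and> E \<psi> \<subseteq> (\<Union>n::nat. B n) \<and> (\<forall>n. box_bounded t (B n))"
proof -
  have "0 < liminf_q2 \<psi>"
    using liminf_q2_nonneg[OF pos] assms(2) by (simp add: less_le)
  then obtain b where b: "0 < b" "ereal b < liminf_q2 \<psi>"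
    using ereal_dense2[of 0 "liminf_q2 \<psi>"] by auto
  obtain t where t: "0 \<le> t" "t < 1" "\<And>h. 0 < h \<Longrightarrow> box_bounded t (gap_set (b / 2) h)"
    using box_bounded_gap_set[of "b / 2"] b by auto
  then show ?thesis
    using E_subset_gap_sets[OF pos b]
    by (intro exI[of _ t] exI[of _ "\<lambda>n. gap_set (b / 2) (inverse (real (Suc n)))"]) auto
qed

lemma countable_E:
  assumes pos: "\<And>q. 1 \<le> q \<Longrightarrow> 0 < \<psi> q" and "ereal (1 / 3) < liminf_q2 \<psi>"
  shows "countable (E \<psi>)"
proof -
  obtain b where b: "1 / 3 < b" "ereal b < liminf_q2 \<psi>"
    using ereal_dense2[OF assms(2)] by auto
  obtain Q where Q: "\<And>q. Q \<le> q \<Longrightarrow> b < (real q)\<^sup>2 * \<psi> q"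
    using less_liminf_q2_eventually[OF b(2)] by blast
  \<comment> \<open>The mean of 1/(3b) and 1: below 1, as the definition of \<open>E\<close>
    demands, yet with c b > 1/3.\<close>
  define c where "c = (1 / (3 * b) + 1) / 2"
  have c: "0 < c" "c < 1" "1 / 3 < c * b"
    using b(1) by (auto simp: c_def field_simps)
  have "E \<psi> \<subseteq> {x. 0 < x \<and> x < 1 \<and> x \<notin> \<rat> \<and>
    (\<exists>Q. \<forall>q\<ge>Q. 1 \<le> q \<longrightarrow> (\<forall>p. c * b / (real q)\<^sup>2 \<le> \<bar>x - of_int p / real q\<bar>))}"
  proof
    fix x assume x: "x \<in> E \<psi>"
    have irr: "x \<notin> \<rat>" by (rule E_irrational[OF x pos])
    then have "x \<noteq> 0" by auto
    then have x01: "0 < x" "x < 1" using E_subset_unit x by fastforce+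
    define S where "S = {(p :: int, q :: nat). 1 \<le> q \<and> \<bar>x - of_int p / of_nat q\<bar> < c * \<psi> q}"
    have "finite (snd ` S)"
      unfolding S_def using E_finite_approximations[OF x c(1,2)] by simp
    then obtain Q' where Q': "\<And>q. q \<in> snd ` S \<Longrightarrow> q < Q'"
      by (auto simp: finite_nat_set_iff_bounded)
    have "c * b / (real q)\<^sup>2 \<le> \<bar>x - of_int p / real q\<bar>" if q: "max Q Q' \<le> q" "1 \<le> q" for q and p :: int
    proof -
      have "q \<notin> snd ` S" using Q'[of q] q by auto
      then have "(p, q) \<notin> S" by (metis imageI snd_conv)
      then have "c * \<psi> q \<le> \<bar>x - of_int p / real q\<bar>" using q by (auto simp: S_def)
      moreover have "c * b / (real q)\<^sup>2 \<le> c * \<psi> q"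
        using Q[of q] q c by (simp add: field_simps)
      ultimately show ?thesis by linarith
    qed
    then show "x \<in> {x. 0 < x \<and> x < 1 \<and> x \<notin> \<rat> \<and>
        (\<exists>Q. \<forall>q\<ge>Q. 1 \<le> q \<longrightarrow> (\<forall>p. c * b / (real q)\<^sup>2 \<le> \<bar>x - of_int p / real q\<bar>))}"
      using x01 irr by blast
  qed
  then show ?thesis
    using countable_large_approximation_constant[OF c(3)] by (rule countable_subset)
qed

lemma countable_box_bounded_cover:
  fixes A :: "'a::metric_space set"
  assumes "countable A"
  shows "\<exists>B. A \<subseteq> (\<Union>n::nat. B n) \<and> (\<forall>n. box_bounded 0 (B n))"
proof (intro exI conjI allI)
  show "A \<subseteq> (\<Union>n. {from_nat_into A n})"
    using from_nat_into_surj[OF assms] by fastforce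
qed (rule box_bounded_singleton)

context
  fixes \<psi> :: "'n::finite \<Rightarrow> nat \<Rightarrow> real" and l :: 'n and t :: real and B :: "nat \<Rightarrow> real set"
  assumes t: "0 \<le> t" and cover: "E (\<psi> l) \<subseteq> (\<Union>n. B n)" and box: "\<And>n. box_bounded t (B n)"
begin

lemma dimP_prodE_le: "dimP (prodE \<psi>) \<le> ereal (real CARD('n) - 1 + t)"
proof -
  let ?B = "\<lambda>n i. if i = l then B n else {0..<1}" and ?t = "\<lambda>i. if i = l then t else 1"
  have "prodE \<psi> \<subseteq> (\<Union>n. {x. \<forall>i. x $ i \<in> ?B n i})"
  proof
    fix x assume "x \<in> prodE \<psi>"
    then have x: "x $ i \<in> E (\<psi> i)" for i by (simp add: prodE_def)
    then obtain n where "x $ l \<in> B n" using cover by blast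
    then show "x \<in> (\<Union>n. {x. \<forall>i. x $ i \<in> ?B n i})"
      using x subsetD[OF E_subset_unit x] by (auto intro!: exI[of _ n])
  qed
  then have "dimP (prodE \<psi>) \<le> ereal (\<Sum>i\<in>UNIV. ?t i)"
    by (rule dimP_box_le) (use t box box_bounded_unit_interval in auto)
  also have "(\<Sum>i\<in>UNIV. ?t i) = real CARD('n) - 1 + t"
    by (subst sum.remove[of UNIV l]) (auto simp: card_Diff_singleton of_nat_diff Suc_leI)
  finally show ?thesis .
qed

text \<open>Factor \<open>k\<close> enters with its Hausdorff dimension, factor \<open>l\<close>
  with \<open>t\<close>, and each of the remaining m - 2 factors lies in [0,1) and counts 1.\<close>

lemma dimH_prodE_le:
  assumes "k \<noteq> l"
  shows "dimH (prodE \<psi>) \<le> dimH (E (\<psi> k)) + ereal (real CARD('n) - 2 + t)"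
proof -
  let ?B = "\<lambda>n i. if i = k then E (\<psi> k) else if i = l then B n else {0..<1}"
  let ?t = "\<lambda>i. if i = l then t else 1"
  have "prodE \<psi> \<subseteq> (\<Union>n. {x. \<forall>i. x $ i \<in> ?B n i})"
  proof
    fix x assume "x \<in> prodE \<psi>"
    then have x: "x $ i \<in> E (\<psi> i)" for i by (simp add: prodE_def)
    then obtain n where "x $ l \<in> B n" using cover by blast
    then show "x \<in> (\<Union>n. {x. \<forall>i. x $ i \<in> ?B n i})"
      using x subsetD[OF E_subset_unit x] by (auto intro!: exI[of _ n])
  qed
  then have "dimH (prodE \<psi>) \<le> dimH (E (\<psi> k)) + ereal (\<Sum>i\<in>UNIV - {k}. ?t i)"
    by (rule dimH_box_le) (use t box box_bounded_unit_interval in auto)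
  also have "(\<Sum>i\<in>UNIV - {k}. ?t i) = real CARD('n) - 2 + t"
  proof -
    have "card {k, l} \<le> CARD('n)" by (rule card_mono) auto
    then have "2 \<le> CARD('n)" using assms by simp
    moreover have "(\<Sum>i\<in>UNIV - {k}. ?t i) = t + (\<Sum>i\<in>UNIV - {k} - {l}. ?t i)"
      using assms by (subst sum.remove[of _ l]) auto
    moreover have "(\<Sum>i\<in>UNIV - {k} - {l}. ?t i) = (\<Sum>i\<in>UNIV - {k} - {l}. 1)"
      by (rule sum.cong) auto
    moreover have "card (UNIV - {k} - {l}) = CARD('n) - 2"
      using assms by (simp add: card_Diff_singleton)
    ultimately show ?thesis by (simp add: of_nat_diff)
  qed
  finally show ?thesis .
qed

end

lemma dimH_E_le_1: "dimH (E \<psi>) \<le> 1"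
proof -
  have "dimH (E \<psi>) \<le> dimP (E \<psi>)" by (rule dimH_le_dimP)
  also have "\<dots> \<le> ereal 1"
    using dimP_le_box[of "E \<psi>" "\<lambda>_. {0..<1}" 1] E_subset_unit box_bounded_unit_interval by auto
  finally show ?thesis by (simp add: one_ereal_def)
qed

text \<open>The finite type \<open>'n\<close> is the index set, so m is \<open>CARD('n)\<close> and
  at least 1; in place of a relabelling the exceptional index is an arbitrary
  \<open>k\<close>.\<close>

theorem theorem1p2:
  fixes \<psi> :: "'n::finite \<Rightarrow> nat \<Rightarrow> real"
  assumes "\<And>i q. 1 \<le> q \<Longrightarrow> 0 < \<psi> i q"
  shows
    "(dimP (prodE \<psi>) = ereal (real CARD('n)) \<longrightarrow> (\<forall>i. liminf_q2 (\<psi> i) = 0)) \<and>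
     (dimH (prodE \<psi>) = ereal (real CARD('n) - 1) + (MIN i\<in>UNIV. dimH (E (\<psi> i))) \<longrightarrow>
        card {i. liminf_q2 (\<psi> i) \<noteq> 0} \<le> 1 \<and>
        (\<forall>k. liminf_q2 (\<psi> k) \<noteq> 0 \<and> 2 \<le> CARD('n) \<and> ereal (1/3) < liminf_q2 (\<psi> k) \<longrightarrow>
           (\<forall>i. i \<noteq> k \<longrightarrow> dimH (E (\<psi> i)) = 1) \<and>
           dimH (E (\<psi> k)) = 0 \<and>
           dimH (prodE \<psi>) = ereal (real CARD('n) - 1) \<and>
           dimP (prodE \<psi>) = ereal (real CARD('n) - 1)))"
proof (intro conjI impI)
  assume full: "dimP (prodE \<psi>) = ereal (real CARD('n))"
  show "\<forall>i. liminf_q2 (\<psi> i) = 0"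
  proof (intro allI, rule ccontr)
    fix l assume "liminf_q2 (\<psi> l) \<noteq> 0"
    then obtain t B where t: "0 \<le> t" "t < 1" "E (\<psi> l) \<subseteq> (\<Union>n::nat. B n)" "\<And>n. box_bounded t (B n)"
      using E_box_bounded_cover[of "\<psi> l"] assms by blast
    have "dimP (prodE \<psi>) \<le> ereal (real CARD('n) - 1 + t)"
      by (rule dimP_prodE_le) (use t in auto)
    then show False using full t(2) by simp
  qed
next
  let ?min = "MIN i\<in>UNIV. dimH (E (\<psi> i))"
  assume H: "dimH (prodE \<psi>) = ereal (real CARD('n) - 1) + ?min"
  have "?min \<in> range (\<lambda>i. dimH (E (\<psi> i)))" by (rule Min_in) auto
  then obtain k0 where k0: "?min = dimH (E (\<psi> k0))" by (rule rangeE)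
  show "card {i. liminf_q2 (\<psi> i) \<noteq> 0} \<le> 1"
  proof (rule ccontr)
    assume "\<not> card {i. liminf_q2 (\<psi> i) \<noteq> 0} \<le> 1"
    then have "\<not> {i. liminf_q2 (\<psi> i) \<noteq> 0} \<subseteq> {k0}"
      using card_mono[of "{k0}" "{i. liminf_q2 (\<psi> i) \<noteq> 0}"] by auto
    \<comment> \<open>Of two exceptional indices one differs from the index \<open>k0\<close> of the
      minimum; with it the upper bound falls short of the assumed value by 1 - t.\<close>
    then obtain l where l: "liminf_q2 (\<psi> l) \<noteq> 0" "k0 \<noteq> l" by auto
    then obtain t B where t: "0 \<le> t" "t < 1" "E (\<psi> l) \<subseteq> (\<Union>n::nat. B n)" "\<And>n. box_bounded t (B n)"
      using E_box_bounded_cover[of "\<psi> l"] assms by blast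
    have "dimH (prodE \<psi>) \<le> dimH (E (\<psi> k0)) + ereal (real CARD('n) - 2 + t)"
      by (rule dimH_prodE_le[OF _ _ _ l(2)]) (use t in auto)
    \<comment> \<open>Finiteness permits cancelling this dimension in the extended reals.\<close>
    moreover obtain d where "dimH (E (\<psi> k0)) = ereal d"
      using dimH_nonneg[of "E (\<psi> k0)"] dimH_E_le_1[of "\<psi> k0"]
      by (cases "dimH (E (\<psi> k0))") auto
    ultimately show False using H k0 t(2) by simp
  qed
  show "\<forall>k. liminf_q2 (\<psi> k) \<noteq> 0 \<and> 2 \<le> CARD('n) \<and> ereal (1/3) < liminf_q2 (\<psi> k) \<longrightarrow>
           (\<forall>i. i \<noteq> k \<longrightarrow> dimH (E (\<psi> i)) = 1) \<and>
           dimH (E (\<psi> k)) = 0 \<and>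
           dimH (prodE \<psi>) = ereal (real CARD('n) - 1) \<and>
           dimP (prodE \<psi>) = ereal (real CARD('n) - 1)"
  proof (intro allI impI)
    fix k
    assume "liminf_q2 (\<psi> k) \<noteq> 0 \<and> 2 \<le> CARD('n) \<and> ereal (1/3) < liminf_q2 (\<psi> k)"
    then have "countable (E (\<psi> k))"
      using countable_E[of "\<psi> k"] assms by blast
    then obtain B where B: "E (\<psi> k) \<subseteq> (\<Union>n::nat. B n)" "\<And>n. box_bounded 0 (B n)"
      using countable_box_bounded_cover by blast
    have "dimH (E (\<psi> k)) \<le> dimP (E (\<psi> k))" by (rule dimH_le_dimP)
    also have "\<dots> \<le> ereal 0" by (rule dimP_le_box[OF B]) simp
    finally have Ek: "dimH (E (\<psi> k)) = 0"
      using dimH_nonneg[of "E (\<psi> k)"] by (simp add: zero_ereal_def)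
    have "?min \<le> dimH (E (\<psi> k))" by (rule Min_le) auto
    then have "?min = 0"
      using Ek k0 dimH_nonneg[of "E (\<psi> k0)"] by simp
    then have prod: "dimH (prodE \<psi>) = ereal (real CARD('n) - 1)"
      using H by simp
    have "dimH (E (\<psi> i)) = 1" if "i \<noteq> k" for i
    proof -
      \<comment> \<open>For t = 0 the bound reads m - 1 \<le> dimH (E (\<psi> i)) + m - 2, which
        leaves no room below 1.\<close>
      have "dimH (prodE \<psi>) \<le> dimH (E (\<psi> i)) + ereal (real CARD('n) - 2 + 0)"
        by (rule dimH_prodE_le[OF _ _ _ that]) (use B in auto)
      then show ?thesis
        using prod dimH_nonneg[of "E (\<psi> i)"] dimH_E_le_1[of "\<psi> i"]
        by (cases "dimH (E (\<psi> i))") (auto simp: one_ereal_def)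
    qed
    moreover have "dimP (prodE \<psi>) = ereal (real CARD('n) - 1)"
    proof (rule antisym)
      have "dimP (prodE \<psi>) \<le> ereal (real CARD('n) - 1 + 0)"
        by (rule dimP_prodE_le) (use B in auto)
      then show "dimP (prodE \<psi>) \<le> ereal (real CARD('n) - 1)" by simp
      show "ereal (real CARD('n) - 1) \<le> dimP (prodE \<psi>)"
        using dimH_le_dimP[of "prodE \<psi>"] prod by simp
    qed
    ultimately show "(\<forall>i. i \<noteq> k \<longrightarrow> dimH (E (\<psi> i)) = 1) \<and> dimH (E (\<psi> k)) = 0 \<and>
        dimH (prodE \<psi>) = ereal (real CARD('n) - 1) \<and> dimP (prodE \<psi>) = ereal (real CARD('n) - 1)"
      using Ek prod by blast
  qed
qed

end
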